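(* Every connected minuscule poset $P$ is mCDE and CDE.
   Context: For a finite poset $P$, the down-degree of $p$ is $\#\{q\in P:q\lessdot p\}$. For a positive integer $m$, $X^{(m)}_P$ is the down-degree random variable on $P$ under the distribution assigning $p$ probability proportional to the number of $m$-element multichains $p_1\le\cdots\le p_m$ in $P$ passing through $p$ (for $m=1$ this is the uniform distribution, and $X_P:=X^{(1)}_P$). $Y_P$ is the down-degree random variable under the distribution assigning $p$ probability proportional to the number of maximal chains of $P$ containing $p$. $P$ is CDE if $\mathbb{E}(X_P)=\mathbb{E}(Y_P)$, and mCDE if $\mathbb{E}(X^{(m)}_P)$ is the same for all $m\ge1$. Connected minuscule posets: let $\Phi$ be an irreducible crystallographic root system with a choice of simple roots, and order the positive roots $\Phi^+$ by $\beta\le\gamma$ iff $\gamma-\beta$ is a nonnegative integer combination of simple roots. For a minuscule simple root $\alpha$ (a simple root whose coefficient in the highest root is $1$), the associated connected minuscule poset is the subposet $\{\beta\in\Phi^+:\beta\ge\alpha\}$. Up to isomorphism these are: products of two chains; the interval $[\varnothing,(b,b)]$ in Young's lattice; the posets consisting of a chain $w_1<\dots<w_a$, then two incomparable elements both covering $w_a$, both covered by the bottom of a chain $z_1<\dots<z_a$; and the two exceptional posets arising from $E_6$ and $E_7$. *)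

theory Defs
  imports "HOL-Probability.Probability"
begin

section \<open>Down-degree expectations on a finite poset\<close>

text \<open>
  A finite poset is given by a finite carrier set \<open>P\<close> and a relation \<open>le\<close> that is
  only relevant on \<open>P\<close>.
\<close>

definition finite_poset :: "'a set \<Rightarrow> ('a \<Rightarrow> 'a \<Rightarrow> bool) \<Rightarrow> bool" where
  "finite_poset P le \<longleftrightarrow> finite P \<and> partial_order_on P (relation_of le P)"

definition covered_by :: "'a set \<Rightarrow> ('a \<Rightarrow> 'a \<Rightarrow> bool) \<Rightarrow> 'a \<Rightarrow> 'a \<Rightarrow> bool" where
  "covered_by P le q p \<longleftrightarrow> q \<in> P \<and> p \<in> P \<and> le q p \<and> q \<noteq> p \<and>
     \<not> (\<exists>r\<in>P. le q r \<and> le r p \<and> r \<noteq> q \<and> r \<noteq> p)"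

definition down_degree :: "'a set \<Rightarrow> ('a \<Rightarrow> 'a \<Rightarrow> bool) \<Rightarrow> 'a \<Rightarrow> nat" where
  "down_degree P le p = card {q \<in> P. covered_by P le q p}"

text \<open>
  The distribution on \<open>P\<close> proportional to \<open>w\<close>. It is meaningful for finite \<open>P\<close> with
  nonzero total weight; see \<open>pmf_proportional_pmf\<close>.
\<close>

definition proportional_pmf :: "'a set \<Rightarrow> ('a \<Rightarrow> nat) \<Rightarrow> 'a pmf" where
  "proportional_pmf P w =
     embed_pmf (\<lambda>p. if p \<in> P then real (w p) / (\<Sum>q\<in>P. real (w q)) else 0)"

text \<open>
  A multichain passing through \<open>p\<close> is counted once, however often \<open>p\<close> occurs in it.
\<close>

definition multichains_through ::
    "'a set \<Rightarrow> ('a \<Rightarrow> 'a \<Rightarrow> bool) \<Rightarrow> nat \<Rightarrow> 'a \<Rightarrow> 'a list set" where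
  "multichains_through P le m p =
     {xs. length xs = m \<and> set xs \<subseteq> P \<and> sorted_wrt le xs \<and> p \<in> set xs}"

definition multichain_pmf :: "'a set \<Rightarrow> ('a \<Rightarrow> 'a \<Rightarrow> bool) \<Rightarrow> nat \<Rightarrow> 'a pmf" where
  "multichain_pmf P le m = proportional_pmf P (\<lambda>p. card (multichains_through P le m p))"

definition maxchain_pmf :: "'a set \<Rightarrow> ('a \<Rightarrow> 'a \<Rightarrow> bool) \<Rightarrow> 'a pmf" where
  "maxchain_pmf P le = proportional_pmf P (\<lambda>p. card {C. pred_on.maxchain P le C \<and> p \<in> C})"

definition expected_down_degree :: "'a set \<Rightarrow> ('a \<Rightarrow> 'a \<Rightarrow> bool) \<Rightarrow> 'a pmf \<Rightarrow> real" where
  "expected_down_degree P le D = measure_pmf.expectation D (\<lambda>p. real (down_degree P le p))"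

definition CDE :: "'a set \<Rightarrow> ('a \<Rightarrow> 'a \<Rightarrow> bool) \<Rightarrow> bool" where
  "CDE P le \<longleftrightarrow>
     expected_down_degree P le (multichain_pmf P le 1) =
     expected_down_degree P le (maxchain_pmf P le)"

definition mCDE :: "'a set \<Rightarrow> ('a \<Rightarrow> 'a \<Rightarrow> bool) \<Rightarrow> bool" where
  "mCDE P le \<longleftrightarrow> (\<forall>m\<ge>1. \<forall>n\<ge>1.
     expected_down_degree P le (multichain_pmf P le m) =
     expected_down_degree P le (multichain_pmf P le n))"

subsection \<open>Well-definedness of the distributions\<close>

lemma pmf_proportional_pmf:
  assumes "finite P" "(\<Sum>q\<in>P. w q) \<noteq> 0"
  shows "pmf (proportional_pmf P w) p =
    (if p \<in> P then real (w p) / (\<Sum>q\<in>P. real (w q)) else 0)"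
  unfolding proportional_pmf_def
proof (rule pmf_embed_pmf)
  let ?f = "\<lambda>p. if p \<in> P then real (w p) / (\<Sum>q\<in>P. real (w q)) else 0"
  show nn: "0 \<le> ?f x" for x by (simp add: sum_nonneg)
  have "(\<Sum>q\<in>P. real (w q)) \<noteq> 0"
    using assms(2) by (metis of_nat_eq_0_iff of_nat_sum)
  then have "(\<Sum>x\<in>P. ?f x) = 1" by (simp flip: sum_divide_distrib)
  moreover have "(\<integral>\<^sup>+ x. ennreal (?f x) \<partial>count_space UNIV) = (\<Sum>x\<in>P. ennreal (?f x))"
    by (rule nn_integral_count_space'[OF assms(1)]) (simp_all del: sum_ennreal)
  moreover have "(\<Sum>x\<in>P. ennreal (?f x)) = ennreal (\<Sum>x\<in>P. ?f x)"
    by (rule sum_ennreal[OF nn])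
  ultimately show "(\<integral>\<^sup>+ x. ennreal (?f x) \<partial>count_space UNIV) = 1" by simp
qed

lemma expected_down_degree_proportional_pmf:
  assumes "finite P" "(\<Sum>q\<in>P. w q) \<noteq> 0"
  shows "expected_down_degree P le (proportional_pmf P w) =
    (\<Sum>p\<in>P. real (w p) * real (down_degree P le p)) / (\<Sum>p\<in>P. real (w p))"
proof -
  have "set_pmf (proportional_pmf P w) \<subseteq> P"
    using pmf_proportional_pmf[OF assms] by (auto simp: set_pmf_eq)
  then show ?thesis
    unfolding expected_down_degree_def
    by (subst integral_measure_pmf[OF assms(1)])
      (auto simp: pmf_proportional_pmf[OF assms] sum_divide_distrib intro!: sum.cong)
qed

lemma finite_posetD:
  assumes "finite_poset P le"
  shows "finite P" "\<And>x. x \<in> P \<Longrightarrow> le x x"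
  using assms
  by (auto simp: finite_poset_def partial_order_on_def preorder_on_def refl_on_def relation_of_def)

lemma multichain_weight_nonzero:
  assumes "finite_poset P le" "P \<noteq> {}" "m \<ge> 1"
  shows "(\<Sum>p\<in>P. card (multichains_through P le m p)) \<noteq> 0"
proof -
  note P = finite_posetD[OF assms(1)]
  obtain p where p: "p \<in> P" using assms(2) by blast
  have "finite {xs. set xs \<subseteq> P \<and> length xs = m}"
    by (rule finite_lists_length_eq[OF P(1)])
  then have "finite (multichains_through P le m p)"
    by (rule rev_finite_subset) (auto simp: multichains_through_def)
  moreover have "replicate m p \<in> multichains_through P le m p"
    using p P(2) assms(3) by (auto simp: multichains_through_def sorted_wrt_iff_nth_less)
  ultimately show ?thesis using p P(1) by (auto simp: card_eq_0_iff)
qed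

lemma maxchain_weight_nonzero:
  assumes "finite_poset P le" "P \<noteq> {}"
  shows "(\<Sum>p\<in>P. card {C. pred_on.maxchain P le C \<and> p \<in> C}) \<noteq> 0"
proof -
  note P = finite_posetD[OF assms(1)]
  obtain p where p: "p \<in> P" using assms(2) by blast
  obtain C where C: "pred_on.maxchain P le C"
    using pred_on.Hausdorff by blast
  have CP: "C' \<subseteq> P" if "pred_on.maxchain P le C'" for C'
    using that by (auto simp: pred_on.maxchain_def pred_on.chain_def)
  have "C \<noteq> {}"
  proof
    assume "C = {}"
    moreover have "pred_on.chain P le {p}" using p by (auto simp: pred_on.chain_def)
    ultimately show False using C by (auto simp: pred_on.maxchain_def)
  qed
  then obtain q where q: "q \<in> C" by blast
  have "finite {C. pred_on.maxchain P le C \<and> q \<in> C}"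
    by (rule finite_subset[of _ "Pow P"]) (use CP P(1) in auto)
  then show ?thesis using q C CP P(1) by (auto simp: card_eq_0_iff)
qed

lemma multichain_pmf_1:
  assumes "finite_poset P le" "P \<noteq> {}"
  shows "multichain_pmf P le 1 = pmf_of_set P"
proof (rule pmf_eqI)
  fix p
  note P = finite_posetD[OF assms(1)]
  have one: "multichains_through P le 1 q = {[q]}" if "q \<in> P" for q
    using that by (auto simp: multichains_through_def length_Suc_conv)
  show "pmf (multichain_pmf P le 1) p = pmf (pmf_of_set P) p"
    unfolding multichain_pmf_def
    by (subst pmf_proportional_pmf[OF P(1) multichain_weight_nonzero[OF assms order_refl]])
      (simp add: one[simplified] P(1) assms(2) indicator_def)
qed

section \<open>Root systems and minuscule posets\<close>

definition root_reflection :: "'a::euclidean_space \<Rightarrow> 'a \<Rightarrow> 'a" where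
  "root_reflection \<alpha> \<beta> = \<beta> - (2 * (\<beta> \<bullet> \<alpha>) / (\<alpha> \<bullet> \<alpha>)) *\<^sub>R \<alpha>"

text \<open>Reduced crystallographic root systems spanning the ambient Euclidean space.\<close>

definition root_system :: "'a::euclidean_space set \<Rightarrow> bool" where
  "root_system \<Phi> \<longleftrightarrow>
     finite \<Phi> \<and> span \<Phi> = UNIV \<and> 0 \<notin> \<Phi> \<and>
     (\<forall>\<alpha>\<in>\<Phi>. \<forall>c. c *\<^sub>R \<alpha> \<in> \<Phi> \<longrightarrow> c = 1 \<or> c = -1) \<and>
     (\<forall>\<alpha>\<in>\<Phi>. \<forall>\<beta>\<in>\<Phi>. root_reflection \<alpha> \<beta> \<in> \<Phi>) \<and>
     (\<forall>\<alpha>\<in>\<Phi>. \<forall>\<beta>\<in>\<Phi>. 2 * (\<beta> \<bullet> \<alpha>) / (\<alpha> \<bullet> \<alpha>) \<in> \<int>)"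

definition irreducible_root_system :: "'a::euclidean_space set \<Rightarrow> bool" where
  "irreducible_root_system \<Phi> \<longleftrightarrow> root_system \<Phi> \<and> \<Phi> \<noteq> {} \<and>
     \<not> (\<exists>A B. A \<noteq> {} \<and> B \<noteq> {} \<and> A \<union> B = \<Phi> \<and> A \<inter> B = {} \<and> (\<forall>a\<in>A. \<forall>b\<in>B. a \<bullet> b = 0))"

definition nonneg_int_combinations :: "'a::euclidean_space set \<Rightarrow> 'a set" where
  "nonneg_int_combinations \<Delta> = {v. \<exists>c :: 'a \<Rightarrow> nat. v = (\<Sum>\<delta>\<in>\<Delta>. real (c \<delta>) *\<^sub>R \<delta>)}"

definition simple_roots :: "'a::euclidean_space set \<Rightarrow> 'a set \<Rightarrow> bool" where
  "simple_roots \<Phi> \<Delta> \<longleftrightarrow> \<Delta> \<subseteq> \<Phi> \<and> independent \<Delta> \<and> span \<Delta> = UNIV \<and>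
     (\<forall>\<beta>\<in>\<Phi>. \<beta> \<in> nonneg_int_combinations \<Delta> \<or> - \<beta> \<in> nonneg_int_combinations \<Delta>)"

definition positive_roots :: "'a::euclidean_space set \<Rightarrow> 'a set \<Rightarrow> 'a set" where
  "positive_roots \<Phi> \<Delta> = {\<beta> \<in> \<Phi>. \<beta> \<in> nonneg_int_combinations \<Delta>}"

definition root_le :: "'a::euclidean_space set \<Rightarrow> 'a \<Rightarrow> 'a \<Rightarrow> bool" where
  "root_le \<Delta> \<beta> \<gamma> \<longleftrightarrow> \<gamma> - \<beta> \<in> nonneg_int_combinations \<Delta>"

definition highest_root :: "'a::euclidean_space set \<Rightarrow> 'a set \<Rightarrow> 'a \<Rightarrow> bool" where
  "highest_root \<Phi> \<Delta> \<theta> \<longleftrightarrow>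
     \<theta> \<in> positive_roots \<Phi> \<Delta> \<and> (\<forall>\<beta>\<in>positive_roots \<Phi> \<Delta>. root_le \<Delta> \<beta> \<theta>)"

definition minuscule_root :: "'a::euclidean_space set \<Rightarrow> 'a set \<Rightarrow> 'a \<Rightarrow> bool" where
  "minuscule_root \<Phi> \<Delta> \<alpha> \<longleftrightarrow>
     \<alpha> \<in> \<Delta> \<and> (\<exists>\<theta>. highest_root \<Phi> \<Delta> \<theta> \<and> representation \<Delta> \<theta> \<alpha> = 1)"

definition minuscule_poset :: "'a::euclidean_space set \<Rightarrow> 'a set \<Rightarrow> 'a \<Rightarrow> 'a set" where
  "minuscule_poset \<Phi> \<Delta> \<alpha> = {\<beta> \<in> positive_roots \<Phi> \<Delta>. root_le \<Delta> \<alpha> \<beta>}"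

subsection \<open>Minuscule posets are nonempty finite posets\<close>

lemma nonneg_int_combinationsI:
  "(\<Sum>\<delta>\<in>\<Delta>. real (c \<delta>) *\<^sub>R \<delta>) \<in> nonneg_int_combinations \<Delta>"
  unfolding nonneg_int_combinations_def by blast

lemma nonneg_int_combinations_0: "0 \<in> nonneg_int_combinations \<Delta>"
  using nonneg_int_combinationsI[of "\<lambda>_. 0" \<Delta>] by simp

lemma nonneg_int_combinations_add:
  assumes "u \<in> nonneg_int_combinations \<Delta>" "v \<in> nonneg_int_combinations \<Delta>"
  shows "u + v \<in> nonneg_int_combinations \<Delta>"
proof -
  obtain c d :: "'a \<Rightarrow> nat" where "u = (\<Sum>\<delta>\<in>\<Delta>. real (c \<delta>) *\<^sub>R \<delta>)" "v = (\<Sum>\<delta>\<in>\<Delta>. real (d \<delta>) *\<^sub>R \<delta>)"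
    using assms unfolding nonneg_int_combinations_def by blast
  then have "u + v = (\<Sum>\<delta>\<in>\<Delta>. real (c \<delta> + d \<delta>) *\<^sub>R \<delta>)"
    by (simp add: sum.distrib scaleR_left_distrib)
  then show ?thesis by (metis nonneg_int_combinationsI[of "\<lambda>\<delta>. c \<delta> + d \<delta>" \<Delta>])
qed

lemma nonneg_int_combinations_antisym:
  assumes "independent \<Delta>" "u \<in> nonneg_int_combinations \<Delta>" "- u \<in> nonneg_int_combinations \<Delta>"
  shows "u = 0"
proof -
  obtain c d :: "'a \<Rightarrow> nat" where
    c: "u = (\<Sum>\<delta>\<in>\<Delta>. real (c \<delta>) *\<^sub>R \<delta>)" and d: "- u = (\<Sum>\<delta>\<in>\<Delta>. real (d \<delta>) *\<^sub>R \<delta>)"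
    using assms unfolding nonneg_int_combinations_def by blast
  have "(\<Sum>\<delta>\<in>\<Delta>. real (c \<delta> + d \<delta>) *\<^sub>R \<delta>) = u + - u"
    unfolding d unfolding c by (simp add: sum.distrib scaleR_left_distrib)
  then have z: "(\<Sum>\<delta>\<in>\<Delta>. real (c \<delta> + d \<delta>) *\<^sub>R \<delta>) = 0" by simp
  have "real (c \<delta> + d \<delta>) = 0" if "\<delta> \<in> \<Delta>" for \<delta>
    by (rule independentD[OF assms(1) _ order_refl z that])
      (rule independent_imp_finite[OF assms(1)])
  then have "c \<delta> = 0" if "\<delta> \<in> \<Delta>" for \<delta> using that by fastforce
  then show ?thesis by (simp add: c)
qed

lemma finite_poset_minuscule_poset:
  assumes "root_system \<Phi>" "simple_roots \<Phi> \<Delta>"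
  shows "finite_poset (minuscule_poset \<Phi> \<Delta> \<alpha>) (root_le \<Delta>)"
proof -
  have ind: "independent \<Delta>" using assms(2) by (simp add: simple_roots_def)
  have "finite (minuscule_poset \<Phi> \<Delta> \<alpha>)"
    using assms(1) by (auto simp: root_system_def minuscule_poset_def positive_roots_def)
  moreover have "root_le \<Delta> x x" for x
    by (simp add: root_le_def nonneg_int_combinations_0)
  moreover have "root_le \<Delta> x z" if "root_le \<Delta> x y" "root_le \<Delta> y z" for x y z
    using nonneg_int_combinations_add[of "y - x" \<Delta> "z - y"] that by (simp add: root_le_def)
  moreover have "x = y" if "root_le \<Delta> x y" "root_le \<Delta> y x" for x y
    using nonneg_int_combinations_antisym[OF ind, of "y - x"] that by (simp add: root_le_def)
  ultimately show ?thesis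
    unfolding finite_poset_def partial_order_on_def preorder_on_def refl_on_def relation_of_def
    by (auto intro!: transI antisymI)
qed

lemma simple_root_in_minuscule_poset:
  assumes "simple_roots \<Phi> \<Delta>" "\<alpha> \<in> \<Delta>"
  shows "\<alpha> \<in> minuscule_poset \<Phi> \<Delta> \<alpha>"
proof -
  have fin: "finite \<Delta>"
    using assms(1) independent_imp_finite by (auto simp: simple_roots_def)
  have "(\<Sum>\<delta>\<in>\<Delta>. real (if \<delta> = \<alpha> then 1 else 0) *\<^sub>R \<delta>) = (\<Sum>\<delta>\<in>\<Delta>. if \<delta> = \<alpha> then \<delta> else 0)"
    by (rule sum.cong) auto
  also have "\<dots> = \<alpha>" using fin assms(2) by simp
  finally have "\<alpha> \<in> nonneg_int_combinations \<Delta>"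
    using nonneg_int_combinationsI[of "\<lambda>\<delta>. if \<delta> = \<alpha> then 1 else 0" \<Delta>] by simp
  then show ?thesis
    using assms by (auto simp: minuscule_poset_def positive_roots_def simple_roots_def root_le_def
        nonneg_int_combinations_0)
qed

end

theory Submission
  imports Defs
begin

text \<open>
  The proof is uniform and avoids the classification. Let \<open>P\<close> be the poset, that is, the set of
  roots with \<open>\<alpha>\<close>-coefficient 1. No root has \<open>\<alpha>\<close>-coefficient \<open>\<plusminus>2\<close>, so reflecting shows
  \<open>\<langle>\<delta>, x\<^sup>\<or>\<rangle> \<in> {-1, 0, 1}\<close> for \<open>x \<in> P\<close> and simple \<open>\<delta> \<noteq> \<alpha>\<close>, and this number is
  \<open>[x - \<delta> \<in> P] - [x + \<delta> \<in> P]\<close>. Let \<open>f(x)\<close> be the number of \<open>k\<close>-element chains through \<open>x\<close>. An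
  involution on chains shows that \<open>f\<close> has the same sum over \<open>{x. c\<^sub>\<delta>(x) = r, x + \<delta> \<in> P}\<close> as over its
  translate by \<open>\<delta>\<close>, where \<open>c\<^sub>\<delta>\<close> is the \<open>\<delta>\<close>-coefficient. Summing
  \<open>2 = \<langle>x, x\<^sup>\<or>\<rangle> = \<langle>\<alpha>, x\<^sup>\<or>\<rangle> + (\<Sum>\<delta>\<noteq>\<alpha>. c\<^sub>\<delta>(x) \<langle>\<delta>, x\<^sup>\<or>\<rangle>)\<close> with weights \<open>f\<close> expresses the
  weighted down-degree sum by the weighted sum \<open>t\<close> of \<open>\<langle>\<alpha>, x\<^sup>\<or>\<rangle>\<close>.

  The weighted sum of the coroots \<open>x\<^sup>\<or>\<close> is orthogonal to all simple \<open>\<delta> \<noteq> \<alpha>\<close>, hence determined up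
  to a scalar. If all elements of \<open>P\<close> have the same length, comparing \<open>\<alpha>\<close>-coefficients yields
  \<open>t\<close>. Otherwise there are two lengths with ratio \<open>\<surd>2\<close>. Then either \<open>P\<close> is a chain (type B), where
  \<open>f\<close> is constant, or the long elements are pairwise orthogonal and \<open>P\<close> consists of their midpoints
  (type C); in this case a second formula for the down-degree determines \<open>t\<close>.

  The weights of the \<open>m\<close>-multichain distributions are combinations of the chain counts with
  coefficients independent of the element, and \<open>P\<close> is graded, so its maximal chains are the
  \<open>n\<close>-element chains for one \<open>n\<close>.
\<close>

section \<open>Chains in a finite poset\<close>

locale fin_poset =
  fixes P :: "'a set" and le :: "'a \<Rightarrow> 'a \<Rightarrow> bool"
  assumes poset: "finite_poset P le"
begin

lemma fin: "finite P"
  using poset by (simp add: finite_poset_def)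

lemma refl: "x \<in> P \<Longrightarrow> le x x"
  using finite_posetD(2)[OF poset] .

lemma antisym: "x \<in> P \<Longrightarrow> y \<in> P \<Longrightarrow> le x y \<Longrightarrow> le y x \<Longrightarrow> x = y"
  using poset
  by (auto simp: finite_poset_def partial_order_on_def antisym_def relation_of_def)

lemma trans: "x \<in> P \<Longrightarrow> y \<in> P \<Longrightarrow> z \<in> P \<Longrightarrow> le x y \<Longrightarrow> le y z \<Longrightarrow> le x z"
  using poset
  unfolding finite_poset_def partial_order_on_def preorder_on_def trans_def relation_of_def
  by blast

definition chains :: "'a set set" where
  "chains = {C. C \<subseteq> P \<and> (\<forall>x\<in>C. \<forall>y\<in>C. le x y \<or> le y x)}"

definition k_chains :: "nat \<Rightarrow> 'a set set" where
  "k_chains k = {C \<in> chains. card C = k}"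

definition chain_weight :: "nat \<Rightarrow> 'a \<Rightarrow> nat" where
  "chain_weight k p = card {C \<in> k_chains k. p \<in> C}"

lemma finite_chains: "finite chains"
  by (rule finite_subset[of _ "Pow P"]) (auto simp: chains_def fin)

lemma finite_k_chains: "finite (k_chains k)"
  using finite_chains by (simp add: k_chains_def)

lemma finite_chain: "C \<in> chains \<Longrightarrow> finite C"
  using fin finite_subset by (auto simp: chains_def)

text \<open>The rank of an element is the number of elements of the chain strictly below it. The
  isomorphism with an initial segment of the naturals serves twice: to reverse chains and to encode
  multichains as sorted lists of numbers.\<close>

lemma chain_rank:
  assumes "C \<in> chains"
  obtains h where "bij_betw h C {..<card C}"
    and "\<And>x y. x \<in> C \<Longrightarrow> y \<in> C \<Longrightarrow> le x y \<longleftrightarrow> h x \<le> (h y :: nat)"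
proof -
  define h where "h x = card {y \<in> C. le y x \<and> y \<noteq> x}" for x
  have CP: "C \<subseteq> P" and tot: "\<And>x y. x \<in> C \<Longrightarrow> y \<in> C \<Longrightarrow> le x y \<or> le y x"
    using assms by (auto simp: chains_def)
  note fC = finite_chain[OF assms]
  have mono: "h x < h y" if "x \<in> C" "y \<in> C" "le x y" "x \<noteq> y" for x y
    unfolding h_def
  proof (rule psubset_card_mono)
    show "finite {z \<in> C. le z y \<and> z \<noteq> y}" using fC by simp
    have "{z \<in> C. le z x \<and> z \<noteq> x} \<subseteq> {z \<in> C. le z y \<and> z \<noteq> y}"
    proof (intro subsetI CollectI)
      fix z assume "z \<in> {z \<in> C. le z x \<and> z \<noteq> x}"
      then have z: "z \<in> C" "le z x" "z \<noteq> x" by auto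
      have P: "x \<in> P" "y \<in> P" "z \<in> P" using that z CP by auto
      then have "le z y" using trans[OF P(3,1,2)] z that by blast
      moreover have "z \<noteq> y" using antisym[OF P(1,2)] z that by blast
      ultimately show "z \<in> C \<and> le z y \<and> z \<noteq> y" using z by blast
    qed
    moreover have "x \<in> {z \<in> C. le z y \<and> z \<noteq> y}" "x \<notin> {z \<in> C. le z x \<and> z \<noteq> x}"
      using that by auto
    ultimately show "{z \<in> C. le z x \<and> z \<noteq> x} \<subset> {z \<in> C. le z y \<and> z \<noteq> y}" by blast
  qed
  have iff: "le x y \<longleftrightarrow> h x \<le> h y" if "x \<in> C" "y \<in> C" for x y
  proof (cases "x = y")
    case True
    then show ?thesis using that CP refl by auto
  next
    case False
    then show ?thesis
      using mono[of x y] mono[of y x] tot[of x y] that CP antisym[of x y] by fastforce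
  qed
  have inj: "inj_on h C"
    using iff CP antisym by (intro inj_onI) (metis order_refl subsetD)
  have "h ` C \<subseteq> {..<card C}"
    unfolding h_def using fC by (auto intro!: psubset_card_mono)
  then have "h ` C = {..<card C}"
    by (intro card_subset_eq) (auto simp: card_image[OF inj])
  then have "bij_betw h C {..<card C}" using inj by (simp add: bij_betw_def)
  then show thesis using iff that by blast
qed

lemma chain_reversal:
  assumes "Z \<in> chains"
  shows "\<exists>r. (\<forall>x\<in>Z. r x \<in> Z \<and> r (r x) = x) \<and> (\<forall>x\<in>Z. \<forall>y\<in>Z. le x y \<longrightarrow> le (r y) (r x))"
proof -
  obtain h where h: "bij_betw h Z {..<card Z}"
    and iff: "\<And>x y. x \<in> Z \<Longrightarrow> y \<in> Z \<Longrightarrow> le x y \<longleftrightarrow> h x \<le> h y"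
    using chain_rank[OF assms] by blast
  define r where "r x = inv_into Z h (card Z - 1 - h x)" for x
  have lt: "h x < card Z" if "x \<in> Z" for x using h that by (auto simp: bij_betw_def)
  have img: "card Z - 1 - h x \<in> h ` Z" if "x \<in> Z" for x
  proof -
    have "card Z - 1 - h x < card Z" using lt[OF that] by linarith
    then show ?thesis using h by (auto simp: bij_betw_def)
  qed
  have rZ: "r x \<in> Z" if "x \<in> Z" for x
    using inv_into_into[OF img[OF that]] by (simp add: r_def)
  have hr: "h (r x) = card Z - 1 - h x" if "x \<in> Z" for x
    using f_inv_into_f[OF img[OF that]] by (simp add: r_def)
  have "r (r x) = x" if "x \<in> Z" for x
  proof -
    have "h (r (r x)) = h x" using hr[OF rZ[OF that]] hr[OF that] lt[OF that] by linarith
    then show ?thesis using h rZ that by (meson bij_betw_def inj_on_eq_iff)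
  qed
  then show ?thesis using rZ hr iff by (intro exI[of _ r]) auto
qed

text \<open>
  The set \<open>U \<union> \<sigma> ` U\<close> is a copy of \<open>U \<times> {0, 1}\<close> whose two layers have the same comparabilities with
  the rest of \<open>P\<close>. Reversing the projection of a chain to \<open>U\<close> while swapping the layers is an
  involution on chains that exchanges the numbers of elements in \<open>U\<close> and in \<open>\<sigma> ` U\<close>.
\<close>

lemma toggle_symmetric:
  assumes UP: "U \<subseteq> P" and DP: "\<sigma> ` U \<subseteq> P" and inj: "inj_on \<sigma> U"
    and ss: "\<And>z z'. z \<in> U \<Longrightarrow> z' \<in> U \<Longrightarrow> le (\<sigma> z) (\<sigma> z') \<longleftrightarrow> le z z'"
    and ud: "\<And>z z'. z \<in> U \<Longrightarrow> z' \<in> U \<Longrightarrow> le z (\<sigma> z') \<longleftrightarrow> le z z'"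
    and si: "\<And>z z'. z \<in> U \<Longrightarrow> z' \<in> U \<Longrightarrow> \<not> le (\<sigma> z) z'"
    and below: "\<And>z r. z \<in> U \<Longrightarrow> r \<in> P - U - \<sigma> ` U \<Longrightarrow> le r z \<longleftrightarrow> le r (\<sigma> z)"
    and above: "\<And>z r. z \<in> U \<Longrightarrow> r \<in> P - U - \<sigma> ` U \<Longrightarrow> le z r \<longleftrightarrow> le (\<sigma> z) r"
  shows "(\<Sum>x\<in>U. chain_weight k x) = (\<Sum>x\<in>U. chain_weight k (\<sigma> x))"
proof -
  have disj: "\<sigma> x \<notin> U" if "x \<in> U" for x
    using si[OF that, of "\<sigma> x"] refl UP by auto
  have fU: "finite U" using UP fin finite_subset by blast
  \<comment> \<open>Both layers are recorded as subsets of \<open>U\<close>. A chain can contain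
    \<open>x\<close> together with \<open>\<sigma> x\<close>, so \<open>A C\<close> and
    \<open>B C\<close> may overlap.\<close>
  define A where "A C = {x \<in> U. x \<in> C}" for C
  define B where "B C = {x \<in> U. \<sigma> x \<in> C}" for C
  define R where "R C = C - U - \<sigma> ` U" for C
  \<comment> \<open>The reversal is chosen as a function of the set alone. Since
    \<open>\<phi>\<close> preserves \<open>A C \<union> B C\<close>, applying it twice uses the same
    reversal, which makes it an involution.\<close>
  define \<rho> where "\<rho> Z = (SOME r. (\<forall>x\<in>Z. r x \<in> Z \<and> r (r x) = x) \<and>
      (\<forall>x\<in>Z. \<forall>y\<in>Z. le x y \<longrightarrow> le (r y) (r x)))" for Z
  define \<phi> where "\<phi> C = R C \<union> \<rho> (A C \<union> B C) ` B C \<union> \<sigma> ` \<rho> (A C \<union> B C) ` A C" for C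
  have AB: "A C \<union> B C \<in> chains" if "C \<in> chains" for C
  proof -
    have "le x y \<or> le y x" if xy: "x \<in> A C \<union> B C" "y \<in> A C \<union> B C" for x y
    proof -
      have U: "x \<in> U" "y \<in> U" using xy by (auto simp: A_def B_def)
      have tot: "le u v \<or> le v u" if "u \<in> C" "v \<in> C" for u v
        using \<open>C \<in> chains\<close> that by (auto simp: chains_def)
      show ?thesis
        using xy U ss[OF U] ss[OF U(2) U(1)] ud[OF U] ud[OF U(2) U(1)] si[OF U] si[OF U(2) U(1)]
          tot[of x y] tot[of x "\<sigma> y"] tot[of "\<sigma> x" y] tot[of "\<sigma> x" "\<sigma> y"]
        by (auto simp: A_def B_def)
    qed
    then show ?thesis using UP by (auto simp: chains_def A_def B_def)
  qed
  have dec: "C = R C \<union> A C \<union> \<sigma> ` B C" if "C \<in> chains" for C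
    by (auto simp: R_def A_def B_def)
  have \<rho>: "(\<forall>x\<in>Z. \<rho> Z x \<in> Z \<and> \<rho> Z (\<rho> Z x) = x) \<and> (\<forall>x\<in>Z. \<forall>y\<in>Z. le x y \<longrightarrow> le (\<rho> Z y) (\<rho> Z x))"
    if "Z \<in> chains" for Z
    unfolding \<rho>_def by (fact someI_ex[OF chain_reversal[OF that]])
  have main: "\<phi> C \<in> chains" "card (\<phi> C) = card C" "\<phi> (\<phi> C) = C" "card (A (\<phi> C)) = card (B C)"
    if C: "C \<in> chains" for C
  proof -
    define Z where "Z = A C \<union> B C"
    define r where "r = \<rho> Z"
    have Z: "Z \<in> chains" unfolding Z_def by (rule AB[OF C])
    have rZ: "\<And>x. x \<in> Z \<Longrightarrow> r x \<in> Z" and rr: "\<And>x. x \<in> Z \<Longrightarrow> r (r x) = x"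
      and rle: "\<And>x y. x \<in> Z \<Longrightarrow> y \<in> Z \<Longrightarrow> le x y \<Longrightarrow> le (r y) (r x)"
      using \<rho>[OF Z] by (auto simp: r_def)
    have ZU: "Z \<subseteq> U" by (auto simp: Z_def A_def B_def)
    have inj_r: "inj_on r Z" using rr by (metis inj_onI)
    have \<phi>C: "\<phi> C = R C \<union> r ` B C \<union> \<sigma> ` r ` A C"
      by (simp add: \<phi>_def r_def Z_def)
    have AZ: "A C \<subseteq> Z" and BZ: "B C \<subseteq> Z" by (auto simp: Z_def)
    have rAU: "r ` A C \<subseteq> U" "r ` B C \<subseteq> U" using AZ BZ rZ ZU by blast+
    have RU: "R C \<inter> U = {}" "R C \<inter> \<sigma> ` U = {}" "R C \<subseteq> P"
      using C by (auto simp: R_def chains_def)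
    have A': "A (\<phi> C) = r ` B C"
      using rAU RU disj unfolding \<phi>C A_def by auto
    have B': "B (\<phi> C) = r ` A C"
    proof -
      have "x \<in> r ` A C" if "x \<in> U" "\<sigma> x \<in> \<phi> C" for x
      proof -
        have "\<sigma> x \<in> \<sigma> ` r ` A C" using that rAU RU disj[OF that(1)] unfolding \<phi>C by blast
        then show ?thesis using inj_on_image_mem_iff[OF inj that(1) rAU(1)] by blast
      qed
      then show ?thesis using rAU unfolding B_def \<phi>C by auto
    qed
    have R': "R (\<phi> C) = R C"
      using rAU RU unfolding \<phi>C by (auto simp: R_def)
    have img: "r ` r ` X = X" if "X \<subseteq> Z" for X
      using that rr by (force simp: image_image)
    have Z': "A (\<phi> C) \<union> B (\<phi> C) = Z"
    proof -
      have "A (\<phi> C) \<union> B (\<phi> C) = r ` Z" by (auto simp: A' B' Z_def)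
      also have "\<dots> = Z" using rZ rr by force
      finally show ?thesis .
    qed
    show "\<phi> (\<phi> C) = C"
    proof -
      have "\<phi> (\<phi> C) = R (\<phi> C) \<union> r ` B (\<phi> C) \<union> \<sigma> ` r ` A (\<phi> C)"
        unfolding \<phi>_def[of "\<phi> C"] Z' r_def ..
      then have "\<phi> (\<phi> C) = R C \<union> r ` r ` A C \<union> \<sigma> ` r ` r ` B C"
        by (simp only: R' A' B')
      then show ?thesis using dec[OF C] img[OF AZ] img[OF BZ] by simp
    qed
    show "card (A (\<phi> C)) = card (B C)"
      unfolding A' by (rule card_image) (rule inj_on_subset[OF inj_r BZ])
    have fin': "finite (R C)" "finite (A C)" "finite (B C)"
      using finite_chain[OF C] fU by (auto simp: R_def A_def B_def)
    have cd: "card (R C \<union> X \<union> \<sigma> ` Y) = card (R C) + card X + card Y"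
      if "X \<subseteq> U" "Y \<subseteq> U" for X Y
    proof -
      have f: "finite X" "finite Y" using that fU finite_subset by blast+
      have "(R C \<union> X) \<inter> \<sigma> ` Y = {}" using that disj RU by blast
      then have "card (R C \<union> X \<union> \<sigma> ` Y) = card (R C \<union> X) + card (\<sigma> ` Y)"
        using f fin' by (intro card_Un_disjoint) auto
      also have "card (R C \<union> X) = card (R C) + card X"
        by (rule card_Un_disjoint) (use f fin' that RU in auto)
      also have "card (\<sigma> ` Y) = card Y"
        by (rule card_image) (rule inj_on_subset[OF inj that(2)])
      finally show ?thesis .
    qed
    have "card (\<phi> C) = card (R C) + card (r ` B C) + card (r ` A C)"
      unfolding \<phi>C using rAU by (intro cd) auto
    also have "\<dots> = card (R C) + card (A C) + card (B C)"
      using card_image[OF inj_on_subset[OF inj_r AZ]] card_image[OF inj_on_subset[OF inj_r BZ]] by simp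
    also have "\<dots> = card C"
      using cd[of "A C" "B C"] dec[OF C] by (auto simp: A_def B_def)
    finally show "card (\<phi> C) = card C" .
    have totC: "le u v \<or> le v u" if "u \<in> C" "v \<in> C" for u v
      using C that by (auto simp: chains_def)
    have totZ: "le u v \<or> le v u" if "u \<in> Z" "v \<in> Z" for u v
      using Z that by (auto simp: chains_def)
    have RZ: "(le x z \<or> le z x) \<and> (le x (\<sigma> z) \<or> le (\<sigma> z) x)" if "x \<in> R C" "z \<in> Z" for x z
    proof -
      have "x \<in> C" "x \<in> P - U - \<sigma> ` U" using that RU by (auto simp: R_def)
      moreover have "z \<in> U" "z \<in> C \<or> \<sigma> z \<in> C" using that ZU by (auto simp: Z_def A_def B_def)
      ultimately show ?thesis using totC[of x z] totC[of x "\<sigma> z"] below[of z x] above[of z x] by blast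
    qed
    \<comment> \<open>In a chain, elements of the lower layer project below those of the upper
      layer. Reversal puts \<open>r b\<close> below \<open>r a\<close>, which fits the swapped
      layers, where \<open>r b\<close> belongs to the lower one.\<close>
    have BA: "le (r b) (r a)" if "a \<in> A C" "b \<in> B C" for a b
    proof (rule rle)
      show "a \<in> Z" "b \<in> Z" using that AZ BZ by auto
      have "le a (\<sigma> b) \<or> le (\<sigma> b) a" by (rule totC) (use that in \<open>auto simp: A_def B_def\<close>)
      then show "le a b" using si[of b a] ud[of a b] that by (auto simp: A_def B_def)
    qed
    have tot: "le x y \<or> le y x" if xy: "x \<in> \<phi> C" "y \<in> \<phi> C" for x y
    proof -
      have sub: "r ` A C \<subseteq> Z" "r ` B C \<subseteq> Z" using AZ BZ rZ by auto
      have 1: "le u v \<or> le v u" if "u \<in> R C" "v \<in> R C" for u v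
        using totC that by (auto simp: R_def)
      have 2: "le u v \<or> le v u" if "u \<in> R C" "v \<in> r ` B C \<union> \<sigma> ` r ` A C" for u v
        using that RZ[of u] sub by blast
      have 3: "le u v \<or> le v u" if "u \<in> r ` B C" "v \<in> r ` B C" for u v
        using that totZ sub by blast
      have 4: "le u v \<or> le v u" if *: "u \<in> \<sigma> ` r ` A C" "v \<in> \<sigma> ` r ` A C" for u v
      proof -
        obtain u' v' where uv: "u = \<sigma> u'" "v = \<sigma> v'" "u' \<in> r ` A C" "v' \<in> r ` A C" using * by blast
        then have Z': "u' \<in> Z" "v' \<in> Z" using sub by auto
        then have "u' \<in> U" "v' \<in> U" using ZU by auto
        then show ?thesis using totZ[OF Z'] ss uv(1,2) by simp
      qed
      have 5: "le u v \<or> le v u" if *: "u \<in> r ` B C" "v \<in> \<sigma> ` r ` A C" for u v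
      proof -
        obtain b a where ab: "u = r b" "v = \<sigma> (r a)" "a \<in> A C" "b \<in> B C" using * by blast
        have "r a \<in> U" "r b \<in> U" using ab rAU by blast+
        then have "le u v" using BA[OF ab(3,4)] ud[of "r b" "r a"] ab by blast
        then show ?thesis ..
      qed
      have "x \<in> R C \<or> x \<in> r ` B C \<or> x \<in> \<sigma> ` r ` A C" "y \<in> R C \<or> y \<in> r ` B C \<or> y \<in> \<sigma> ` r ` A C"
        using xy unfolding \<phi>C by simp_all
      then show ?thesis
        using 1[of x y] 2[of x y] 2[of y x] 3[of x y] 4[of x y] 5[of x y] 5[of y x] by (metis UnI1 UnI2)
    qed
    have "\<phi> C \<subseteq> P" unfolding \<phi>C using RU rAU UP DP by blast
    then show "\<phi> C \<in> chains" using tot by (auto simp: chains_def)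
  qed
  \<comment> \<open>Double counting of pairs of an element and a chain; needed for \<open>g\<close>
    the identity and for \<open>g = \<sigma>\<close>.\<close>
  have swap: "(\<Sum>x\<in>U. chain_weight k (g x)) = (\<Sum>C\<in>k_chains k. card {x \<in> U. g x \<in> C})" for g
  proof -
    have "(\<Sum>x\<in>U. chain_weight k (g x)) = (\<Sum>x\<in>U. \<Sum>C\<in>k_chains k. if g x \<in> C then 1 else 0)"
      by (rule sum.cong)
        (auto simp: chain_weight_def finite_k_chains Int_def simp flip: sum.inter_filter)
    also have "\<dots> = (\<Sum>C\<in>k_chains k. \<Sum>x\<in>U. if g x \<in> C then 1 else 0)" by (rule sum.swap)
    also have "\<dots> = (\<Sum>C\<in>k_chains k. card {x \<in> U. g x \<in> C})"
      by (rule sum.cong) (auto simp: fU simp flip: sum.inter_filter)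
    finally show ?thesis .
  qed
  have "(\<Sum>C\<in>k_chains k. card (B C)) = (\<Sum>C\<in>k_chains k. card (A C))"
    by (rule sum.reindex_bij_witness[of _ \<phi> \<phi>]) (auto simp: k_chains_def main)
  then show ?thesis using swap[of "\<lambda>x. x"] swap[of \<sigma>] by (simp add: A_def B_def)
qed

section \<open>Multichains counted by their supporting chains\<close>

text \<open>These lists encode the ways to stretch a \<open>k\<close>-element chain to a multichain
  of length \<open>m\<close>: each entry is the rank of the element at that position.\<close>

definition surjective_sorted_lists :: "nat \<Rightarrow> nat \<Rightarrow> nat list set" where
  "surjective_sorted_lists m k = {ys. length ys = m \<and> sorted ys \<and> set ys = {..<k}}"

text \<open>Replacing elements by their ranks turns multichains into sorted lists of numbers, so the
  count depends on the support only through its size.\<close>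

lemma card_multichains_with_support:
  assumes "C \<in> chains"
  shows "card {xs. length xs = m \<and> sorted_wrt le xs \<and> set xs = C} =
    card (surjective_sorted_lists m (card C))"
proof -
  obtain h where h: "bij_betw h C {..<card C}"
    and iff: "\<And>x y. x \<in> C \<Longrightarrow> y \<in> C \<Longrightarrow> le x y \<longleftrightarrow> h x \<le> h y"
    using chain_rank[OF assms] by blast
  have inj: "inj_on h C" and img: "h ` C = {..<card C}" using h by (auto simp: bij_betw_def)
  have sorted: "sorted_wrt le xs \<longleftrightarrow> sorted (map h xs)" if "set xs \<subseteq> C" for xs
  proof -
    have "le (xs ! i) (xs ! j) \<longleftrightarrow> h (xs ! i) \<le> h (xs ! j)" if "i < j" "j < length xs" for i j
      using that \<open>set xs \<subseteq> C\<close> by (intro iff) auto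
    then show ?thesis unfolding sorted_wrt_map sorted_wrt_iff_nth_less by (simp cong: imp_cong)
  qed
  have "bij_betw (map h) {xs. length xs = m \<and> sorted_wrt le xs \<and> set xs = C}
     (surjective_sorted_lists m (card C))"
  proof (rule bij_betw_imageI)
    show "inj_on (map h) {xs. length xs = m \<and> sorted_wrt le xs \<and> set xs = C}"
    proof (rule inj_onI)
      fix xs ys
      assume "xs \<in> {xs. length xs = m \<and> sorted_wrt le xs \<and> set xs = C}"
        "ys \<in> {xs. length xs = m \<and> sorted_wrt le xs \<and> set xs = C}" "map h xs = map h ys"
      then show "xs = ys" using inj by (intro map_inj_on[of h xs ys]) simp_all
    qed
    show "map h ` {xs. length xs = m \<and> sorted_wrt le xs \<and> set xs = C} =
       surjective_sorted_lists m (card C)"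
    proof (intro equalityI subsetI)
      fix ys assume "ys \<in> surjective_sorted_lists m (card C)"
      then have ys: "length ys = m" "sorted ys" "set ys = h ` C"
        by (auto simp: surjective_sorted_lists_def img)
      define xs where "xs = map (inv_into C h) ys"
      have m: "map h xs = ys"
        unfolding xs_def map_map using ys(3) by (intro map_idI) (simp add: f_inv_into_f)
      have s: "set xs = C"
        unfolding xs_def using ys(3) inj by (simp add: inv_into_image_cancel)
      then have "sorted_wrt le xs" using sorted[of xs] m ys(2) by simp
      then show "ys \<in> map h ` {xs. length xs = m \<and> sorted_wrt le xs \<and> set xs = C}"
        using m s ys(1) by (intro image_eqI[of _ _ xs]) (auto simp flip: m)
    qed (use sorted img in \<open>auto simp: surjective_sorted_lists_def\<close>)
  qed
  then show ?thesis by (rule bij_betw_same_card)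
qed

text \<open>Multichains are grouped by support, and supports by size. The coefficients do not
  involve \<open>p\<close>, so linear identities between chain weights pass to multichain
  weights.\<close>

lemma card_multichains_through:
  "card (multichains_through P le m p) =
    (\<Sum>k\<le>card P. card (surjective_sorted_lists m k) * chain_weight k p)"
proof -
  define F where "F C = {xs. length xs = m \<and> sorted_wrt le xs \<and> set xs = C}" for C
  define K where "K = {C \<in> chains. p \<in> C}"
  have fF: "finite (F C)" if "C \<in> chains" for C
    by (rule finite_subset[OF _ finite_lists_length_eq[OF finite_chain[OF that], of m]])
      (auto simp: F_def)
  have ch: "set xs \<in> chains" if "set xs \<subseteq> P" "sorted_wrt le xs" for xs
  proof -
    have "le x y \<or> le y x" if xy: "x \<in> set xs" "y \<in> set xs" for x y
    proof -
      obtain i j where "i < length xs" "j < length xs" "x = xs ! i" "y = xs ! j"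
        using xy by (auto simp: in_set_conv_nth)
      then show ?thesis
        using \<open>sorted_wrt le xs\<close> refl[of x] subsetD[OF \<open>set xs \<subseteq> P\<close> xy(1)]
        by (cases i j rule: linorder_cases) (auto simp: sorted_wrt_iff_nth_less)
    qed
    then show ?thesis using that(1) by (auto simp: chains_def)
  qed
  have "multichains_through P le m p = (\<Union>C\<in>K. F C)"
    using ch by (auto simp: multichains_through_def K_def F_def chains_def)
  then have "card (multichains_through P le m p) = (\<Sum>C\<in>K. card (F C))"
    by simp (rule card_UN_disjoint, use fF finite_chains in \<open>auto simp: K_def F_def\<close>)
  also have "\<dots> = (\<Sum>C\<in>K. card (surjective_sorted_lists m (card C)))"
    by (rule sum.cong) (auto simp: F_def K_def card_multichains_with_support)
  also have "\<dots> = (\<Sum>k\<le>card P. \<Sum>C\<in>{C \<in> K. card C = k}. card (surjective_sorted_lists m (card C)))"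
    by (rule sum.group[symmetric])
      (use finite_chains in \<open>auto simp: K_def chains_def intro!: card_mono fin\<close>)
  also have "\<dots> = (\<Sum>k\<le>card P. card (surjective_sorted_lists m k) * chain_weight k p)"
  proof (rule sum.cong[OF HOL.refl])
    fix k
    have "{C \<in> K. card C = k} = {C \<in> k_chains k. p \<in> C}" by (auto simp: K_def k_chains_def)
    then show "(\<Sum>C\<in>{C \<in> K. card C = k}. card (surjective_sorted_lists m (card C))) =
        card (surjective_sorted_lists m k) * chain_weight k p"
      unfolding chain_weight_def by (auto simp: k_chains_def)
  qed
  finally show ?thesis .
qed

text \<open>The constant \<open>c\<close> is the same for all \<open>k\<close>, so the identity
  survives linear combinations of the chain weights and the expectation is \<open>c\<close> for
  every \<open>m\<close>.\<close>

lemma mCDE_if_chains_balanced: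
  assumes ne: "P \<noteq> {}"
    and bal: "\<And>k. (\<Sum>p\<in>P. real (chain_weight k p) * real (down_degree P le p)) =
      c * (\<Sum>p\<in>P. real (chain_weight k p))"
  shows "mCDE P le"
    and "m \<ge> 1 \<Longrightarrow> expected_down_degree P le (multichain_pmf P le m) = c"
proof -
  have E: "expected_down_degree P le (multichain_pmf P le m) = c" if "m \<ge> 1" for m
  proof -
    define w where "w p = card (multichains_through P le m p)" for p
    define N where "N k = real (card (surjective_sorted_lists m k))" for k
    have nz: "(\<Sum>p\<in>P. w p) \<noteq> 0"
      unfolding w_def by (rule multichain_weight_nonzero[OF poset ne that])
    have w: "real (w p) = (\<Sum>k\<le>card P. N k * real (chain_weight k p))" for p
      by (simp add: w_def card_multichains_through N_def)
    have s: "(\<Sum>p\<in>P. real (w p) * g p) = (\<Sum>k\<le>card P. N k * (\<Sum>p\<in>P. real (chain_weight k p) * g p))" for g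
    proof -
      have "(\<Sum>p\<in>P. real (w p) * g p) = (\<Sum>p\<in>P. \<Sum>k\<le>card P. N k * (real (chain_weight k p) * g p))"
        by (simp add: w sum_distrib_right mult.assoc)
      also have "\<dots> = (\<Sum>k\<le>card P. \<Sum>p\<in>P. N k * (real (chain_weight k p) * g p))" by (rule sum.swap)
      finally show ?thesis by (simp add: sum_distrib_left)
    qed
    have "(\<Sum>p\<in>P. real (w p) * real (down_degree P le p)) = c * (\<Sum>p\<in>P. real (w p))"
      unfolding s bal using s[of "\<lambda>_. 1"] by (simp add: sum_distrib_left mult_ac)
    moreover have "(\<Sum>p\<in>P. real (w p)) \<noteq> 0" using nz by (metis of_nat_eq_0_iff of_nat_sum)
    ultimately show ?thesis
      unfolding multichain_pmf_def w_def[symmetric]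
      by (simp add: expected_down_degree_proportional_pmf[OF fin nz])
  qed
  then show "mCDE P le" by (simp add: mCDE_def)
  show "m \<ge> 1 \<Longrightarrow> expected_down_degree P le (multichain_pmf P le m) = c" by (rule E)
qed

section \<open>Maximal chains of a graded poset\<close>

lemma chain_iff: "pred_on.chain P le C \<longleftrightarrow> C \<in> chains"
  using refl unfolding pred_on.chain_def chains_def by blast

text \<open>By \<open>mono\<close> a chain has at most one element of each rank, and by
  \<open>step\<close> a maximal chain skips no rank. So the maximal chains are those meeting all
  ranks, which the number of elements detects.\<close>

lemma maxchain_iff_card:
  fixes rk :: "'a \<Rightarrow> nat"
  assumes bot: "b \<in> P" "\<And>x. x \<in> P \<Longrightarrow> le b x" and top: "t \<in> P" "\<And>x. x \<in> P \<Longrightarrow> le x t"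
    and mono: "\<And>x y. x \<in> P \<Longrightarrow> y \<in> P \<Longrightarrow> le x y \<Longrightarrow> x \<noteq> y \<Longrightarrow> rk x < rk y"
    and step: "\<And>x y. x \<in> P \<Longrightarrow> y \<in> P \<Longrightarrow> le x y \<Longrightarrow> x \<noteq> y \<Longrightarrow>
      \<exists>z\<in>P. le x z \<and> le z y \<and> rk z = Suc (rk x)"
  shows "pred_on.maxchain P le C \<longleftrightarrow> C \<in> k_chains (card {rk b..rk t})"
proof -
  have rk_mono: "rk x \<le> rk y" if "x \<in> P" "y \<in> P" "le x y" for x y
    using mono[OF that] by (cases "x = y") auto
  have inj: "inj_on rk C" if "C \<in> chains" for C
  proof (rule inj_onI, rule ccontr)
    fix x y assume "x \<in> C" "y \<in> C" "rk x = rk y" "x \<noteq> y"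
    then show False using that mono[of x y] mono[of y x] by (auto simp: chains_def)
  qed
  have sub: "rk ` C \<subseteq> {rk b..rk t}" if "C \<in> chains" for C
    using that bot top rk_mono by (auto simp: chains_def)
  show ?thesis
  proof
    assume max: "pred_on.maxchain P le C"
    then have C: "C \<in> chains" by (simp add: pred_on.maxchain_def chain_iff)
    have CP: "C \<subseteq> P" using C by (simp add: chains_def)
    have mem: "z \<in> C" if "z \<in> P" "\<And>x. x \<in> C \<Longrightarrow> le x z \<or> le z x" for z
    proof (rule ccontr)
      assume "z \<notin> C"
      moreover have "insert z C \<in> chains"
        using C that refl by (auto simp: chains_def)
      ultimately show False using max by (auto simp: pred_on.maxchain_def chain_iff)
    qed
    have bt: "b \<in> C" "t \<in> C" using mem bot top CP by blast+
    have "n \<in> rk ` C" if n: "n \<in> {rk b..rk t}" for n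
    proof (rule ccontr)
      assume nn: "n \<notin> rk ` C"
      \<comment> \<open>The chain is split at the missing rank \<open>n\<close>. An element one rank
        above the top \<open>x\<close> of \<open>L\<close> and below the bottom \<open>y\<close> of
        \<open>H\<close> is comparable to the whole chain, hence belongs to it; as its rank is not
        \<open>n\<close>, it contradicts the choice of \<open>x\<close>.\<close>
      define L where "L = {x \<in> C. rk x < n}"
      define H where "H = {x \<in> C. rk x > n}"
      have fin: "finite L" "finite H" using finite_chain[OF C] by (auto simp: L_def H_def)
      have "rk b \<noteq> n" "rk t \<noteq> n" using nn bt by auto
      then have "b \<in> L" "t \<in> H" using n bt by (auto simp: L_def H_def)
      then have ne: "L \<noteq> {}" "H \<noteq> {}" by auto
      obtain x where x: "x \<in> L" "rk x = Max (rk ` L)"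
        using Max_in[of "rk ` L"] fin ne by (metis (no_types) finite_imageI image_iff image_is_empty)
      obtain y where y: "y \<in> H" "rk y = Min (rk ` H)"
        using Min_in[of "rk ` H"] fin ne by (metis (no_types) finite_imageI image_iff image_is_empty)
      have xL: "rk u \<le> rk x" if "u \<in> L" for u using that x fin by simp
      have yH: "rk y \<le> rk u" if "u \<in> H" for u using that y fin by simp
      have xy: "x \<in> C" "y \<in> C" "rk x < n" "n < rk y" using x y by (auto simp: L_def H_def)
      have le': "le u v" if "u \<in> C" "v \<in> C" "rk u \<le> rk v" for u v
      proof (rule ccontr)
        assume "\<not> le u v"
        moreover then have "le v u" "u \<noteq> v" using C that refl by (auto simp: chains_def)
        ultimately show False using mono[of v u] that CP by auto
      qed
      obtain z where z: "z \<in> P" "le x z" "le z y" "rk z = Suc (rk x)"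
        using step[of x y] le'[of x y] xy CP by (metis less_imp_le less_trans nat_neq_iff subsetD)
      have "le u z \<or> le z u" if u: "u \<in> C" for u
      proof (cases "rk u < n")
        case True
        then have "le u x" using xL u xy by (auto simp: L_def intro!: le')
        then show ?thesis using trans[of u x z] z u xy CP by blast
      next
        case False
        then have "rk u > n" using nn u by (metis image_eqI linorder_neqE_nat)
        then have "le y u" using yH u xy by (auto simp: H_def intro!: le')
        then show ?thesis using trans[of z y u] z u xy CP by blast
      qed
      then have zC: "z \<in> C" using mem z by blast
      then have "rk z \<noteq> n" using nn by auto
      then have "z \<in> L" using zC z xy by (auto simp: L_def)
      then show False using xL z by fastforce
    qed
    then have "rk ` C = {rk b..rk t}" using sub[OF C] by blast
    then show "C \<in> k_chains (card {rk b..rk t})"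
      using card_image[OF inj[OF C]] C by (simp add: k_chains_def)
  next
    assume "C \<in> k_chains (card {rk b..rk t})"
    then have C: "C \<in> chains" and card: "card C = card {rk b..rk t}" by (auto simp: k_chains_def)
    have "\<not> C \<subset> S" if S: "S \<in> chains" for S
    proof
      assume "C \<subset> S"
      then have "card C < card S" using finite_chain[OF S] by (rule psubset_card_mono[rotated])
      also have "card S = card (rk ` S)" using card_image[OF inj[OF S]] by simp
      also have "\<dots> \<le> card {rk b..rk t}" by (rule card_mono) (use sub[OF S] in auto)
      finally show False using card by simp
    qed
    then show "pred_on.maxchain P le C" using C by (auto simp: pred_on.maxchain_def chain_iff)
  qed
qed

lemma CDE_if_chains_balanced:
  assumes ne: "P \<noteq> {}"
    and bal: "\<And>k. (\<Sum>p\<in>P. real (chain_weight k p) * real (down_degree P le p)) =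
      c * (\<Sum>p\<in>P. real (chain_weight k p))"
    and pure: "\<And>C. pred_on.maxchain P le C \<longleftrightarrow> C \<in> k_chains n"
  shows "CDE P le"
proof -
  have w: "card {C. pred_on.maxchain P le C \<and> p \<in> C} = chain_weight n p" for p
    by (simp add: pure chain_weight_def)
  have nz: "(\<Sum>p\<in>P. chain_weight n p) \<noteq> 0"
    using maxchain_weight_nonzero[OF poset ne] by (simp add: w)
  have "(\<Sum>p\<in>P. real (chain_weight n p)) \<noteq> 0" using nz by (metis of_nat_eq_0_iff of_nat_sum)
  then have "expected_down_degree P le (maxchain_pmf P le) = c"
    unfolding maxchain_pmf_def w
    by (simp add: expected_down_degree_proportional_pmf[OF fin nz] bal)
  then show ?thesis
    using mCDE_if_chains_balanced(2)[OF ne bal order_refl] by (simp add: CDE_def)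
qed

text \<open>All subsets of a totally ordered \<open>P\<close> are chains, and those avoiding
  \<open>p\<close> are subtracted. What matters is that the value is the same for all
  \<open>p\<close>.\<close>

lemma chain_weight_total:
  assumes "P \<in> chains" "p \<in> P"
  shows "chain_weight k p = (card P choose k) - (card P - 1 choose k)"
proof -
  have "{C \<in> k_chains k. p \<in> C} =
      {C. C \<subseteq> P \<and> card C = k} - {C. C \<subseteq> P - {p} \<and> card C = k}"
    using assms by (auto simp: k_chains_def chains_def)
  moreover have "card \<dots> = card {C. C \<subseteq> P \<and> card C = k} - card {C. C \<subseteq> P - {p} \<and> card C = k}"
    by (rule card_Diff_subset) (use fin in \<open>auto intro: finite_subset[of _ "Pow P"]\<close>)
  ultimately show ?thesis
    using assms fin by (simp add: chain_weight_def n_subsets)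
qed

end

section \<open>Natural numbers among the reals\<close>

lemma Nats_nonneg: "n \<in> \<nat> \<Longrightarrow> 0 \<le> (n::real)"
  by (auto elim: Nats_cases)

lemma Nats_pred: "n \<in> \<nat> \<Longrightarrow> n \<noteq> 0 \<Longrightarrow> n - 1 \<in> (\<nat> :: real set)"
proof (elim Nats_cases)
  fix k assume "n \<noteq> 0" "n = real k"
  then have "n - 1 = real (k - 1)" by (simp add: of_nat_diff)
  then show "n - 1 \<in> \<nat>" by simp
qed

lemma Nats_ge_1: "n \<in> \<nat> \<Longrightarrow> n \<noteq> 0 \<Longrightarrow> 1 \<le> (n :: real)"
  by (metis Nats_cases One_nat_def Suc_leI gr0I of_nat_0 of_nat_1 of_nat_le_iff)

section \<open>Root-theoretic structure of minuscule posets\<close>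

locale minuscule =
  fixes \<Phi> \<Delta> :: "'a::euclidean_space set" and \<alpha> :: 'a
  assumes root_system: "root_system \<Phi>"
    and simple: "simple_roots \<Phi> \<Delta>"
    and minuscule: "minuscule_root \<Phi> \<Delta> \<alpha>"
begin

abbreviation P where "P \<equiv> minuscule_poset \<Phi> \<Delta> \<alpha>"
abbreviation le where "le \<equiv> root_le \<Delta>"
abbreviation coef where "coef \<equiv> representation \<Delta>"

definition B where "B = \<Delta> - {\<alpha>}"

text \<open>This is \<open>\<langle>x, y\<^sup>\<or>\<rangle>\<close>, the pairing of
  \<open>x\<close> with the coroot of \<open>y\<close>; it is linear only in the first
  argument.\<close>

definition pairing :: "'a \<Rightarrow> 'a \<Rightarrow> real" where
  "pairing x y = 2 * (x \<bullet> y) / (y \<bullet> y)"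

sublocale fin_poset P le
  by unfold_locales (rule finite_poset_minuscule_poset[OF root_system simple])

section \<open>Coordinates in the basis of simple roots\<close>

lemma independent: "independent \<Delta>" and span: "span \<Delta> = UNIV" and roots: "\<Delta> \<subseteq> \<Phi>"
  using simple by (auto simp: simple_roots_def)

lemma finite_simple: "finite \<Delta>"
  using independent independent_imp_finite by blast

lemma alpha: "\<alpha> \<in> \<Delta>"
  using minuscule by (simp add: minuscule_root_def)

lemma B: "\<delta> \<in> B \<Longrightarrow> \<delta> \<in> \<Delta>" "\<delta> \<in> B \<Longrightarrow> \<delta> \<noteq> \<alpha>" "finite B"
  using finite_simple by (auto simp: B_def)

lemma coef_add: "coef (x + y) \<delta> = coef x \<delta> + coef y \<delta>"
  and coef_diff: "coef (x - y) \<delta> = coef x \<delta> - coef y \<delta>"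
  and coef_scale: "coef (c *\<^sub>R x) \<delta> = c * coef x \<delta>"
  and coef_minus: "coef (- x) \<delta> = - coef x \<delta>"
  using independent span
  by (simp_all add: representation_add representation_diff representation_scale representation_neg)

lemma coef_sum: "coef (\<Sum>i\<in>I. f i) \<delta> = (\<Sum>i\<in>I. coef (f i) \<delta>)"
  using independent span by (simp add: representation_sum)

lemma coef_basis: "\<delta> \<in> \<Delta> \<Longrightarrow> coef \<delta> \<delta>' = (if \<delta>' = \<delta> then 1 else 0)"
  using representation_basis[OF independent] by auto

lemmas coef_simps = coef_add coef_diff coef_scale coef_minus coef_basis

lemma expand: "(\<Sum>\<delta>\<in>\<Delta>. coef v \<delta> *\<^sub>R \<delta>) = v"
  using sum_representation_eq[OF independent, of v \<Delta>] span finite_simple by simp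

lemma expand_inner: "v \<bullet> w = (\<Sum>\<delta>\<in>\<Delta>. coef v \<delta> * (\<delta> \<bullet> w))"
  by (subst (1) expand[symmetric]) (simp add: inner_sum_left)

text \<open>Independence makes the coefficients unique, so they can be read off as coordinates; this
  turns the root order into the coordinatewise condition \<open>le_iff\<close>.\<close>

lemma combination_iff: "v \<in> nonneg_int_combinations \<Delta> \<longleftrightarrow> (\<forall>\<delta>\<in>\<Delta>. coef v \<delta> \<in> \<nat>)"
proof
  assume "v \<in> nonneg_int_combinations \<Delta>"
  then obtain c :: "'a \<Rightarrow> nat" where v: "v = (\<Sum>\<delta>\<in>\<Delta>. real (c \<delta>) *\<^sub>R \<delta>)"
    by (auto simp: nonneg_int_combinations_def)
  have "coef v \<delta> = real (c \<delta>)" if "\<delta> \<in> \<Delta>" for \<delta>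
  proof -
    have "coef v \<delta> = (\<Sum>\<delta>'\<in>\<Delta>. if \<delta> = \<delta>' then real (c \<delta>') else 0)"
      unfolding v coef_sum by (rule sum.cong) (auto simp: coef_simps)
    then show ?thesis using finite_simple that by simp
  qed
  then show "\<forall>\<delta>\<in>\<Delta>. coef v \<delta> \<in> \<nat>" by simp
next
  assume "\<forall>\<delta>\<in>\<Delta>. coef v \<delta> \<in> \<nat>"
  then have "\<forall>\<delta>\<in>\<Delta>. \<exists>n. coef v \<delta> = real n" by (auto elim: Nats_cases)
  then obtain c where c: "\<And>\<delta>. \<delta> \<in> \<Delta> \<Longrightarrow> coef v \<delta> = real (c \<delta>)" by metis
  have "v = (\<Sum>\<delta>\<in>\<Delta>. real (c \<delta>) *\<^sub>R \<delta>)"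
    by (subst expand[symmetric], rule sum.cong) (simp_all add: c)
  then show "v \<in> nonneg_int_combinations \<Delta>" by (auto simp: nonneg_int_combinations_def)
qed

lemma le_iff: "le x y \<longleftrightarrow> (\<forall>\<delta>\<in>\<Delta>. coef y \<delta> - coef x \<delta> \<in> \<nat>)"
  by (simp add: root_le_def combination_iff coef_simps)

lemma le_coef: "le x y \<Longrightarrow> \<delta> \<in> \<Delta> \<Longrightarrow> coef x \<delta> \<le> coef y \<delta>"
  unfolding le_iff by (metis Nats_cases diff_ge_0_iff_ge of_nat_0_le_iff)

lemma root_coef: "\<beta> \<in> \<Phi> \<Longrightarrow> (\<forall>\<delta>\<in>\<Delta>. coef \<beta> \<delta> \<in> \<nat>) \<or> (\<forall>\<delta>\<in>\<Delta>. - coef \<beta> \<delta> \<in> \<nat>)"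
  using simple by (auto simp: simple_roots_def combination_iff coef_simps)

lemma root_mixed:
  assumes "\<beta> \<in> \<Phi>" "\<delta> \<in> \<Delta>" "\<delta>' \<in> \<Delta>" "coef \<beta> \<delta> > 0" "coef \<beta> \<delta>' < 0"
  shows False
  using root_coef[OF assms(1)] assms(2-) Nats_nonneg[of "coef \<beta> \<delta>'"] Nats_nonneg[of "- coef \<beta> \<delta>"]
  by fastforce

section \<open>Reflections and pairings\<close>

lemma root_nz: "\<beta> \<in> \<Phi> \<Longrightarrow> \<beta> \<noteq> 0"
  using root_system by (auto simp: root_system_def)

lemma root_pos: "\<beta> \<in> \<Phi> \<Longrightarrow> 0 < \<beta> \<bullet> \<beta>"
  using root_nz by simp

lemma reflection: "\<gamma> \<in> \<Phi> \<Longrightarrow> \<beta> \<in> \<Phi> \<Longrightarrow> \<beta> - pairing \<beta> \<gamma> *\<^sub>R \<gamma> \<in> \<Phi>"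
  using root_system unfolding root_system_def root_reflection_def pairing_def by blast

lemma pairing_self: "\<beta> \<in> \<Phi> \<Longrightarrow> pairing \<beta> \<beta> = 2"
  using root_pos[of \<beta>] by (simp add: pairing_def)

lemma pairing_add: "pairing (x + y) z = pairing x z + pairing y z"
  and pairing_diff: "pairing (x - y) z = pairing x z - pairing y z"
  by (simp_all add: pairing_def inner_simps distrib_left right_diff_distrib add_divide_distrib diff_divide_distrib)

lemma root_minus: "\<beta> \<in> \<Phi> \<Longrightarrow> - \<beta> \<in> \<Phi>"
  using reflection[of \<beta> \<beta>] by (simp add: pairing_self scaleR_2)

lemma inner_pairing: "y \<in> \<Phi> \<Longrightarrow> x \<bullet> y = pairing x y * (y \<bullet> y) / 2"
  using root_pos[of y] by (simp add: pairing_def)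

text \<open>A positive root lies below the highest root, whose coefficient at \<alpha> is 1, and
  negation covers the other roots. Applied to reflected roots, this yields \<open>pairing_PP\<close>
  and \<open>pairing_BP\<close>.\<close>

lemma coef_alpha: 
  assumes "\<beta> \<in> \<Phi>"
  shows "coef \<beta> \<alpha> \<in> {-1, 0, 1}"
proof -
  obtain \<theta> where \<theta>: "highest_root \<Phi> \<Delta> \<theta>" "coef \<theta> \<alpha> = 1"
    using minuscule by (auto simp: minuscule_root_def)
  have pos: "coef \<gamma> \<alpha> \<in> {0, 1}" if "\<gamma> \<in> \<Phi>" "\<forall>\<delta>\<in>\<Delta>. coef \<gamma> \<delta> \<in> \<nat>" for \<gamma>
  proof -
    have "\<gamma> \<in> positive_roots \<Phi> \<Delta>" using that by (simp add: positive_roots_def combination_iff)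
    then have "coef \<gamma> \<alpha> \<le> 1" using \<theta> le_coef[OF _ alpha] by (fastforce simp: highest_root_def)
    moreover have "coef \<gamma> \<alpha> \<in> \<nat>" using that alpha by blast
    ultimately show ?thesis using Nats_ge_1[of "coef \<gamma> \<alpha>"] by auto
  qed
  show ?thesis
    using root_coef[OF assms] pos[OF assms] pos[OF root_minus[OF assms]] by (auto simp: coef_simps)
qed

text \<open>A root with a positive coefficient at \<alpha> is positive, and above \<alpha> this
  coefficient is at least, hence exactly, 1. Membership of a root in \<open>P\<close> thus becomes a
  single linear equation.\<close>

lemma P_iff: "\<beta> \<in> P \<longleftrightarrow> \<beta> \<in> \<Phi> \<and> coef \<beta> \<alpha> = 1"
proof
  assume "\<beta> \<in> P"
  then have "\<beta> \<in> \<Phi>" "le \<alpha> \<beta>" by (auto simp: minuscule_poset_def positive_roots_def)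
  then show "\<beta> \<in> \<Phi> \<and> coef \<beta> \<alpha> = 1"
    using le_coef[of \<alpha> \<beta> \<alpha>] alpha coef_alpha[of \<beta>] by (auto simp: coef_basis)
next
  assume b: "\<beta> \<in> \<Phi> \<and> coef \<beta> \<alpha> = 1"
  have "- (1::real) \<notin> \<nat>" using Nats_nonneg by fastforce
  then have "\<forall>\<delta>\<in>\<Delta>. coef \<beta> \<delta> \<in> \<nat>" using b root_coef[of \<beta>] alpha by metis
  then show "\<beta> \<in> P"
    using b alpha by (auto simp: minuscule_poset_def positive_roots_def combination_iff le_iff coef_basis)
qed

lemma P_root: "x \<in> P \<Longrightarrow> x \<in> \<Phi>" and P_coef: "x \<in> P \<Longrightarrow> coef x \<alpha> = 1"
  by (auto simp: P_iff)

lemma P_pos: "x \<in> P \<Longrightarrow> 0 < x \<bullet> x"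
  using root_pos P_root by blast

lemma alpha_P: "\<alpha> \<in> P"
  using alpha roots by (auto simp: P_iff coef_basis)

lemma alpha_le: "x \<in> P \<Longrightarrow> le \<alpha> x"
  by (simp add: minuscule_poset_def)

text \<open>Reflecting \<open>x\<close> in \<open>y\<close> gives a root whose coefficient at
  \<alpha> is \<open>1 - pairing x y\<close>.\<close>

lemma pairing_PP: "x \<in> P \<Longrightarrow> y \<in> P \<Longrightarrow> pairing x y \<in> {0, 1, 2}"
  using coef_alpha[OF reflection[OF P_root P_root, of y x]]
  by (auto simp: coef_simps P_coef)

lemma inner_PP:
  assumes "x \<in> P" "y \<in> P"
  shows "0 \<le> x \<bullet> y"
proof -
  have "0 \<le> pairing x y" using pairing_PP[OF assms] by auto
  then show ?thesis by (simp add: inner_pairing[OF P_root[OF assms(2)], of x])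
qed

lemma coef_B: "\<delta> \<in> B \<Longrightarrow> coef \<delta> \<alpha> = 0"
  using B(1,2)[of \<delta>] by (simp add: coef_basis)

lemma B_root: "\<delta> \<in> B \<Longrightarrow> \<delta> \<in> \<Phi>"
  using B roots by auto

lemma pairing_BP: "\<delta> \<in> B \<Longrightarrow> x \<in> P \<Longrightarrow> pairing \<delta> x \<in> {-1, 0, 1}"
  using coef_alpha[OF reflection[OF P_root B_root, of x \<delta>]]
  by (auto simp: coef_simps P_coef coef_B)

lemma pairing_sgn:
  assumes "y \<in> \<Phi>"
  shows "pairing x y > 0 \<longleftrightarrow> x \<bullet> y > 0" "pairing x y < 0 \<longleftrightarrow> x \<bullet> y < 0" "pairing x y = 0 \<longleftrightarrow> x \<bullet> y = 0"
  using root_pos[OF assms] by (auto simp: pairing_def zero_less_divide_iff divide_less_0_iff simp del: inner_gt_zero_iff)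

lemma add_P: "\<delta> \<in> B \<Longrightarrow> x \<in> P \<Longrightarrow> x + \<delta> \<in> P \<longleftrightarrow> x + \<delta> \<in> \<Phi>"
  and sub_P: "\<delta> \<in> B \<Longrightarrow> x \<in> P \<Longrightarrow> x - \<delta> \<in> P \<longleftrightarrow> x - \<delta> \<in> \<Phi>"
  by (auto simp: P_iff coef_add coef_diff coef_B)

lemma neg_add_P:
  assumes "\<delta> \<in> B" "x \<in> P" "\<delta> \<bullet> x < 0"
  shows "x + \<delta> \<in> P"
proof -
  have "pairing \<delta> x = -1"
    using pairing_BP[OF assms(1,2)] pairing_sgn(2)[OF P_root[OF assms(2)], of \<delta>] assms(3) by auto
  then show ?thesis
    using reflection[OF P_root[OF assms(2)] B_root[OF assms(1)]] add_P[OF assms(1,2)]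
    by (simp add: add.commute)
qed

lemma pos_sub_P:
  assumes "\<delta> \<in> B" "x \<in> P" "\<delta> \<bullet> x > 0"
  shows "x - \<delta> \<in> P"
proof -
  have "pairing \<delta> x = 1"
    using pairing_BP[OF assms(1,2)] pairing_sgn(1)[OF P_root[OF assms(2)], of \<delta>] assms(3) by auto
  then have "\<delta> - x \<in> \<Phi>"
    using reflection[OF P_root[OF assms(2)] B_root[OF assms(1)]] by simp
  then show ?thesis using root_minus[of "\<delta> - x"] assms by (simp add: sub_P)
qed

lemma add_P_inner:
  assumes "\<delta> \<in> B" "x \<in> P" "x + \<delta> \<in> P"
  shows "\<delta> \<bullet> x \<le> 0"
proof -
  have "2 + pairing \<delta> x \<in> {0, 1, 2}"
    using pairing_PP[OF assms(3,2)] by (simp add: pairing_add pairing_self[OF P_root[OF assms(2)]])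
  then show ?thesis using pairing_sgn[OF P_root[OF assms(2)], of \<delta>] by fastforce
qed

lemma sub_P_inner:
  assumes "\<delta> \<in> B" "x \<in> P" "x - \<delta> \<in> P"
  shows "\<delta> \<bullet> x \<ge> 0"
proof -
  have "2 - pairing \<delta> x \<in> {0, 1, 2}"
    using pairing_PP[OF assms(3,2)] by (simp add: pairing_diff pairing_self[OF P_root[OF assms(2)]])
  then show ?thesis using pairing_sgn[OF P_root[OF assms(2)], of \<delta>] by fastforce
qed

lemma orthogonal_add_sub:
  assumes "\<delta> \<in> B" "x \<in> P" "\<delta> \<bullet> x = 0"
  shows "x + \<delta> \<in> P \<longleftrightarrow> x - \<delta> \<in> P"
proof -
  have "pairing x \<delta> = 0" using assms by (simp add: pairing_def inner_commute)
  then have p: "pairing (x + \<delta>) \<delta> = 2" "pairing (x - \<delta>) \<delta> = -2"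
    using pairing_self[OF B_root[OF assms(1)]] by (simp_all add: pairing_add pairing_diff)
  show ?thesis
    using reflection[OF B_root[OF assms(1)], of "x + \<delta>"] reflection[OF B_root[OF assms(1)], of "x - \<delta>"]
      add_P[OF assms(1,2)] sub_P[OF assms(1,2)]
    by (auto simp: p scaleR_2)
qed

text \<open>A positive inner product permits only the step down, a negative one only the step up. In
  the orthogonal case the reflection in \<delta> exchanges \<open>x + \<delta>\<close> and
  \<open>x - \<delta>\<close>, so both steps exist or neither does.\<close>

lemma pairing_toggle:
  assumes "\<delta> \<in> B" "x \<in> P"
  shows "pairing \<delta> x = of_bool (x - \<delta> \<in> P) - of_bool (x + \<delta> \<in> P)"
proof -
  note s = pairing_sgn[OF P_root[OF assms(2)], of \<delta>]
  consider "\<delta> \<bullet> x > 0" | "\<delta> \<bullet> x < 0" | "\<delta> \<bullet> x = 0" by linarith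
  then show ?thesis
  proof cases
    case 1
    then show ?thesis
      using pairing_BP[OF assms] s pos_sub_P[OF assms] add_P_inner[OF assms] by auto
  next
    case 2
    then show ?thesis
      using pairing_BP[OF assms] s neg_add_P[OF assms] sub_P_inner[OF assms] by auto
  next
    case 3
    then show ?thesis using s orthogonal_add_sub[OF assms] by auto
  qed
qed

text \<open>Both pairings are 1 or 2, and both being 2 would force \<open>x = y\<close>. If one of
  them is 1, the corresponding reflection is the difference up to sign.\<close>

lemma root_diff:
  assumes "x \<in> P" "y \<in> P" "x \<noteq> y" "x \<bullet> y > 0"
  shows "x - y \<in> \<Phi>"
proof -
  have r: "x \<in> \<Phi>" "y \<in> \<Phi>" using assms P_root by auto
  have "(x - y) \<bullet> (x - y) \<noteq> 0" using assms by simp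
  then have "\<not> (pairing x y = 2 \<and> pairing y x = 2)"
    using inner_pairing[OF r(1), of y] inner_pairing[OF r(2), of x]
    by (auto simp: inner_simps inner_commute)
  moreover have "pairing x y > 0" "pairing y x > 0"
    using assms pairing_sgn(1) r by (auto simp: inner_commute)
  ultimately have "pairing x y = 1 \<or> pairing y x = 1"
    using pairing_PP[of x y] pairing_PP[of y x] assms by auto
  then show ?thesis
    using reflection[OF r(2,1)] root_minus[OF reflection[OF r]] by auto
qed

lemma comparable:
  assumes "x \<in> P" "y \<in> P" "x \<bullet> y > 0"
  shows "le x y \<or> le y x"
proof (cases "x = y")
  case False
  then show ?thesis
    using root_coef[OF root_diff[OF assms(1,2) _ assms(3)]] by (auto simp: le_iff coef_diff)
qed (use refl assms in auto)

lemma simple_obtuse: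
  assumes "\<delta> \<in> \<Delta>" "\<delta>' \<in> \<Delta>" "\<delta> \<noteq> \<delta>'"
  shows "\<delta> \<bullet> \<delta>' \<le> 0"
proof (rule ccontr)
  assume "\<not> ?thesis"
  moreover have r: "\<delta> \<in> \<Phi>" "\<delta>' \<in> \<Phi>" using assms roots by auto
  ultimately have "pairing \<delta> \<delta>' > 0" using pairing_sgn(1)[OF r(2)] by simp
  then show False
    using root_mixed[OF reflection[OF r(2,1)] assms(1,2)] assms by (simp add: coef_simps)
qed

text \<open>Since \<delta> does not occur in \<open>y - x\<close>, only other simple roots
  contribute, and their inner products with \<delta> are at most 0.\<close>

lemma le_inner_simple:
  assumes "le x y" "\<delta> \<in> \<Delta>" "coef x \<delta> = coef y \<delta>"
  shows "y \<bullet> \<delta> \<le> x \<bullet> \<delta>"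
proof -
  have "(y - x) \<bullet> \<delta> = (\<Sum>\<delta>'\<in>\<Delta>. coef (y - x) \<delta>' * (\<delta>' \<bullet> \<delta>))" by (rule expand_inner)
  also have "\<dots> \<le> 0"
  proof (rule sum_nonpos)
    fix \<delta>' assume "\<delta>' \<in> \<Delta>"
    then show "coef (y - x) \<delta>' * (\<delta>' \<bullet> \<delta>) \<le> 0"
      using simple_obtuse[of \<delta>' \<delta>] le_coef[OF assms(1), of \<delta>'] assms
      by (cases "\<delta>' = \<delta>") (auto simp: coef_diff intro!: mult_nonneg_nonpos)
  qed
  finally show ?thesis by (simp add: inner_diff_left)
qed

section \<open>Simple steps, covers and the grading by height\<close>

lemma le_add: "\<delta> \<in> B \<Longrightarrow> le x (x + \<delta>)"
  using B by (auto simp: le_iff coef_simps)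

lemma le_diff: "\<delta> \<in> B \<Longrightarrow> le (x - \<delta>) x"
  using B by (auto simp: le_iff coef_simps)

lemma root_le_trans: "le x y \<Longrightarrow> le y z \<Longrightarrow> le x z"
  unfolding le_iff by (metis Nats_add add_diff_eq diff_add_cancel)

lemma le_add_simple:
  assumes "\<delta> \<in> \<Delta>" "le x y" "coef x \<delta> \<noteq> coef y \<delta>"
  shows "le (x + \<delta>) y"
  unfolding le_iff
proof
  fix \<delta>' assume d: "\<delta>' \<in> \<Delta>"
  then have "coef y \<delta>' - coef x \<delta>' \<in> \<nat>" using assms by (auto simp: le_iff)
  then show "coef y \<delta>' - coef (x + \<delta>) \<delta>' \<in> \<nat>"
    using assms Nats_pred[of "coef y \<delta>' - coef x \<delta>'"] by (auto simp: coef_simps algebra_simps)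
qed

lemma le_sub_iff: "le x (y - \<delta>) \<longleftrightarrow> le (x + \<delta>) y"
  by (simp add: root_le_def algebra_simps)

text \<open>As \<open>y - x\<close> has positive inner product with itself, some simple \<delta> in
  its expansion satisfies \<open>\<delta> \<bullet> x < \<delta> \<bullet> y\<close>. Then the left
  side is negative or the right side positive, which permits a step up from \<open>x\<close> or down
  from \<open>y\<close>.\<close>

lemma step_either:
  assumes "x \<in> P" "y \<in> P" "le x y" "x \<noteq> y"
  shows "\<exists>\<delta>\<in>B. le (x + \<delta>) y \<and> (x + \<delta> \<in> P \<or> y - \<delta> \<in> P)"
proof -
  have "0 < (y - x) \<bullet> (y - x)" using assms by simp
  also have "\<dots> = (\<Sum>\<delta>\<in>\<Delta>. coef (y - x) \<delta> * (\<delta> \<bullet> (y - x)))" by (rule expand_inner)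
  finally obtain \<delta> where d: "\<delta> \<in> \<Delta>" "coef (y - x) \<delta> * (\<delta> \<bullet> (y - x)) > 0"
    by (metis (no_types, lifting) not_less sum_nonpos)
  have c: "coef y \<delta> \<noteq> coef x \<delta>" using d by (auto simp: coef_diff)
  then have "\<delta> \<in> B" using d P_coef assms by (auto simp: B_def)
  moreover have "\<delta> \<bullet> y > \<delta> \<bullet> x"
    using d le_coef[OF assms(3) d(1)] by (auto simp: coef_diff inner_diff_right zero_less_mult_iff)
  then have "\<delta> \<bullet> x < 0 \<or> \<delta> \<bullet> y > 0" by linarith
  then have "x + \<delta> \<in> P \<or> y - \<delta> \<in> P" using neg_add_P pos_sub_P \<open>\<delta> \<in> B\<close> assms by blast
  ultimately show ?thesis using le_add_simple[OF d(1) assms(3)] c by auto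
qed

text \<open>The coefficients are reals, hence the floor and \<open>nat\<close>; on \<open>P\<close>
  nothing is rounded, as the next lemma shows.\<close>

definition height :: "'a \<Rightarrow> nat" where
  "height x = nat \<lfloor>\<Sum>\<delta>\<in>\<Delta>. coef x \<delta>\<rfloor>"

lemma height: 
  assumes "x \<in> P"
  shows "real (height x) = (\<Sum>\<delta>\<in>\<Delta>. coef x \<delta>)"
proof -
  have "\<forall>\<delta>\<in>\<Delta>. coef x \<delta> \<in> \<nat>"
    using assms by (simp add: minuscule_poset_def positive_roots_def combination_iff)
  then have "(\<Sum>\<delta>\<in>S. coef x \<delta>) \<in> \<nat>" if "S \<subseteq> \<Delta>" for S
    using that by (induction S rule: infinite_finite_induct) auto
  from this[OF order_refl]
  show ?thesis by (auto simp: height_def elim: Nats_cases)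
qed

lemma height_add: 
  assumes "x \<in> P" "\<delta> \<in> B" "x + \<delta> \<in> P"
  shows "height (x + \<delta>) = Suc (height x)"
proof -
  have "real (height (x + \<delta>)) = real (height x) + 1"
    using height[OF assms(1)] height[OF assms(3)] B assms finite_simple by (simp add: coef_simps sum.distrib)
  then show ?thesis by linarith
qed

lemma height_mono:
  assumes "x \<in> P" "y \<in> P" "le x y"
  shows "height x \<le> height y"
proof -
  have "real (height x) \<le> real (height y)"
    unfolding height[OF assms(1)] height[OF assms(2)] by (rule sum_mono) (rule le_coef[OF assms(3)])
  then show ?thesis by simp
qed

text \<open>If \<open>step_either\<close> only offers a step down from \<open>y\<close>, the search
  continues with \<open>y - \<delta>\<close>, which differs from \<open>x\<close> because
  \<open>x + \<delta>\<close> is not in \<open>P\<close>.\<close>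

lemma step_up:
  assumes "x \<in> P" "y \<in> P" "le x y" "x \<noteq> y"
  shows "\<exists>\<delta>\<in>B. x + \<delta> \<in> P \<and> le (x + \<delta>) y"
  using assms
proof (induction "height y" arbitrary: y rule: less_induct)
  case less
  obtain \<delta> where d: "\<delta> \<in> B" "le (x + \<delta>) y" "x + \<delta> \<in> P \<or> y - \<delta> \<in> P"
    using step_either[OF less.prems] by blast
  show ?case
  proof (cases "x + \<delta> \<in> P")
    case False
    then have y: "y - \<delta> \<in> P" "x \<noteq> y - \<delta>" using d less.prems by auto
    have "height (y - \<delta>) < height y" using height_add[OF y(1) d(1)] less.prems by simp
    then have "\<exists>\<delta>'\<in>B. x + \<delta>' \<in> P \<and> le (x + \<delta>') (y - \<delta>)"
      using less.hyps[of "y - \<delta>"] y d less.prems le_sub_iff by blast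
    then show ?thesis using root_le_trans[OF _ le_diff[OF d(1)]] by blast
  qed (use d in blast)
qed

lemma step_down:
  assumes "x \<in> P" "y \<in> P" "le x y" "x \<noteq> y"
  shows "\<exists>\<delta>\<in>B. y - \<delta> \<in> P \<and> le x (y - \<delta>)"
  using assms
proof (induction "height y - height x" arbitrary: x rule: less_induct)
  case less
  obtain \<delta> where d: "\<delta> \<in> B" "x + \<delta> \<in> P" "le (x + \<delta>) y"
    using step_up[OF less.prems] by blast
  show ?case
  proof (cases "x + \<delta> = y")
    case True
    then show ?thesis using d less.prems refl by (intro bexI[of _ \<delta>]) auto
  next
    case False
    have "height y - height (x + \<delta>) < height y - height x"
      using height_add[OF less.prems(1) d(1,2)] height_mono[OF d(2) less.prems(2) d(3)] by linarith
    then have "\<exists>\<delta>'\<in>B. y - \<delta>' \<in> P \<and> le (x + \<delta>) (y - \<delta>')"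
      using less.hyps d less.prems False by blast
    then show ?thesis using root_le_trans[OF le_add[OF d(1)]] by blast
  qed
qed

lemma height_strict:
  assumes "x \<in> P" "y \<in> P" "le x y" "x \<noteq> y"
  shows "height x < height y"
proof -
  obtain \<delta> where d: "\<delta> \<in> B" "x + \<delta> \<in> P" "le (x + \<delta>) y"
    using step_up[OF assms] by blast
  show ?thesis using height_add[OF assms(1) d(1,2)] height_mono[OF d(2) assms(2) d(3)] by linarith
qed

text \<open>By \<open>step_down\<close> a cover is a step by a simple root; conversely such a step
  raises the height by one, which leaves no room in between.\<close>

lemma covered_by_iff:
  assumes "p \<in> P"
  shows "covered_by P le q p \<longleftrightarrow> (\<exists>\<delta>\<in>B. q = p - \<delta> \<and> q \<in> P)"
proof
  assume c: "covered_by P le q p"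
  then have q: "q \<in> P" "le q p" "q \<noteq> p" by (auto simp: covered_by_def)
  obtain \<delta> where d: "\<delta> \<in> B" "p - \<delta> \<in> P" "le q (p - \<delta>)"
    using step_down[OF q(1) assms q(2,3)] by blast
  have "p - \<delta> \<noteq> p" using root_nz[OF B_root[OF d(1)]] by simp
  then have "q = p - \<delta>" using c d le_diff[OF d(1)] by (auto simp: covered_by_def)
  then show "\<exists>\<delta>\<in>B. q = p - \<delta> \<and> q \<in> P" using d by blast
next
  assume "\<exists>\<delta>\<in>B. q = p - \<delta> \<and> q \<in> P"
  then obtain \<delta> where d: "\<delta> \<in> B" "q = p - \<delta>" "q \<in> P" by blast
  have h: "height p = Suc (height q)" using height_add[OF d(3,1)] d assms by simp
  have "\<not> (\<exists>r\<in>P. le q r \<and> le r p \<and> r \<noteq> q \<and> r \<noteq> p)"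
  proof
    assume "\<exists>r\<in>P. le q r \<and> le r p \<and> r \<noteq> q \<and> r \<noteq> p"
    then obtain r where "r \<in> P" "le q r" "le r p" "r \<noteq> q" "r \<noteq> p" by blast
    then have "height q < height r" "height r < height p" using height_strict d assms by auto
    then show False using h by simp
  qed
  then show "covered_by P le q p"
    using d assms le_diff root_nz[OF B_root[OF d(1)]] by (auto simp: covered_by_def)
qed

lemma down_degree_eq:
  assumes "p \<in> P"
  shows "down_degree P le p = card {\<delta> \<in> B. p - \<delta> \<in> P}"
proof -
  have "{q \<in> P. covered_by P le q p} = (\<lambda>\<delta>. p - \<delta>) ` {\<delta> \<in> B. p - \<delta> \<in> P}"
    using covered_by_iff[OF assms] by auto
  moreover have "inj_on (\<lambda>\<delta>. p - \<delta>) {\<delta> \<in> B. p - \<delta> \<in> P}" by (auto intro: inj_onI)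
  ultimately show ?thesis by (simp add: down_degree_def card_image)
qed

section \<open>Toggling along a simple root\<close>

text \<open>If \<open>y + \<delta>\<close> were not in \<open>P\<close>, both \<open>x\<close> and
  \<open>y\<close> would be orthogonal to \<delta>. The first step \<epsilon> from \<open>x\<close>
  towards \<open>y\<close> is then orthogonal to \<delta> as well, so \<open>x + \<epsilon>\<close>
  and \<open>x + \<delta>\<close> have positive inner product, and their difference
  \<open>\<epsilon> - \<delta>\<close> would be a root with coefficients of both signs.\<close>

lemma up_closed:
  assumes "\<delta> \<in> B" "x \<in> P" "x + \<delta> \<in> P" "y \<in> P" "le x y" "coef x \<delta> = coef y \<delta>"
  shows "y + \<delta> \<in> P"
proof (cases "x = y")
  case False
  have d: "\<delta> \<in> \<Delta>" using B assms by auto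
  have le1: "y \<bullet> \<delta> \<le> x \<bullet> \<delta>" by (rule le_inner_simple[OF assms(5) d assms(6)])
  have le2: "\<delta> \<bullet> x \<le> 0" by (rule add_P_inner[OF assms(1-3)])
  show ?thesis
  proof (rule ccontr)
    assume n: "y + \<delta> \<notin> P"
    then have z: "\<delta> \<bullet> x = 0" "\<delta> \<bullet> y = 0"
      using neg_add_P[OF assms(1,4)] le1 le2 by (fastforce simp: inner_commute[of _ \<delta>])+
    obtain \<epsilon> where e: "\<epsilon> \<in> B" "x + \<epsilon> \<in> P" "le (x + \<epsilon>) y"
      using step_up[OF assms(2,4,5) False] by blast
    have ne: "\<epsilon> \<noteq> \<delta>" using le_coef[OF e(3) d] assms(6) d by (auto simp: coef_simps)
    have ed: "\<epsilon> \<in> \<Delta>" using B e by auto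
    have "y \<bullet> \<delta> \<le> (x + \<epsilon>) \<bullet> \<delta>"
      using le_inner_simple[OF e(3) d] assms(6) ne ed by (simp add: coef_simps)
    then have "\<epsilon> \<bullet> \<delta> = 0" using z simple_obtuse[OF ed d ne] by (simp add: inner_simps inner_commute)
    have "pairing (x + \<epsilon>) x > 0"
      using pairing_BP[OF e(1) assms(2)] pairing_self[OF P_root[OF assms(2)]] by (auto simp: pairing_add)
    then have "(x + \<epsilon>) \<bullet> (x + \<delta>) > 0"
      using pairing_sgn(1)[OF P_root[OF assms(2)]] z \<open>\<epsilon> \<bullet> \<delta> = 0\<close> by (simp add: inner_simps inner_commute)
    then have "\<epsilon> - \<delta> \<in> \<Phi>" using root_diff[OF e(2) assms(3)] ne by simp
    then show False using root_mixed[OF _ ed d, of "\<epsilon> - \<delta>"] ne ed d by (simp add: coef_simps)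
  qed
qed (use assms in simp)

lemma down_closed:
  assumes "\<delta> \<in> B" "x \<in> P" "x - \<delta> \<in> P" "y \<in> P" "le y x" "coef x \<delta> = coef y \<delta>"
  shows "y - \<delta> \<in> P"
proof (cases "x = y")
  case False
  have d: "\<delta> \<in> \<Delta>" using B assms by auto
  have le1: "x \<bullet> \<delta> \<le> y \<bullet> \<delta>" by (rule le_inner_simple[OF assms(5) d assms(6)[symmetric]])
  have le2: "\<delta> \<bullet> x \<ge> 0" by (rule sub_P_inner[OF assms(1-3)])
  show ?thesis
  proof (rule ccontr)
    assume n: "y - \<delta> \<notin> P"
    then have z: "\<delta> \<bullet> x = 0" "\<delta> \<bullet> y = 0"
      using pos_sub_P[OF assms(1,4)] le1 le2 by (fastforce simp: inner_commute[of _ \<delta>])+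
    obtain \<epsilon> where e: "\<epsilon> \<in> B" "x - \<epsilon> \<in> P" "le y (x - \<epsilon>)"
      using step_down[OF assms(4,2,5)] False by blast
    have ne: "\<epsilon> \<noteq> \<delta>" using le_coef[OF e(3) d] assms(6) d by (auto simp: coef_simps)
    have ed: "\<epsilon> \<in> \<Delta>" using B e by auto
    have "(x - \<epsilon>) \<bullet> \<delta> \<le> y \<bullet> \<delta>"
      using le_inner_simple[OF e(3) d] assms(6) ne ed by (simp add: coef_simps)
    then have "\<epsilon> \<bullet> \<delta> = 0" using z simple_obtuse[OF ed d ne] by (simp add: inner_simps inner_commute)
    have "pairing (x - \<epsilon>) x > 0"
      using pairing_BP[OF e(1) assms(2)] pairing_self[OF P_root[OF assms(2)]] by (auto simp: pairing_diff)
    then have "(x - \<epsilon>) \<bullet> (x - \<delta>) > 0"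
      using pairing_sgn(1)[OF P_root[OF assms(2)]] z \<open>\<epsilon> \<bullet> \<delta> = 0\<close> by (simp add: inner_simps inner_commute)
    then have "\<delta> - \<epsilon> \<in> \<Phi>" using root_diff[OF e(2) assms(3)] ne by simp
    then show False using root_mixed[OF _ d ed, of "\<delta> - \<epsilon>"] ne ed d by (simp add: coef_simps)
  qed
qed (use assms in simp)

section \<open>Balanced weights\<close>

text \<open>The test function \<open>g\<close> encodes equality on every level of the
  \<delta>-coefficient; it is applied with the constant 1 and with the identity.\<close>

definition balanced :: "('a \<Rightarrow> real) \<Rightarrow> bool" where
  "balanced f \<longleftrightarrow> (\<forall>\<delta>\<in>B. \<forall>g. (\<Sum>x | x \<in> P \<and> x + \<delta> \<in> P. f x * g (coef x \<delta>)) =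
     (\<Sum>x | x \<in> P \<and> x + \<delta> \<in> P. f (x + \<delta>) * g (coef x \<delta>)))"

lemma balanced_one: "balanced (\<lambda>_. 1)"
  by (simp add: balanced_def)

text \<open>Each level of the \<delta>-coefficient is an instance of \<open>toggle_symmetric\<close>
  with the shift by \<delta>; the levels are then added up with the weights
  \<open>g\<close>.\<close>

lemma balanced_chain_weight: "balanced (\<lambda>x. real (chain_weight k x))"
  unfolding balanced_def
proof (intro ballI allI)
  fix \<delta> and g :: "real \<Rightarrow> real"
  assume d: "\<delta> \<in> B"
  have d': "\<delta> \<in> \<Delta>" using B d by auto
  define U where "U = {x. x \<in> P \<and> x + \<delta> \<in> P}"
  have fU: "finite U" unfolding U_def using fin by simp
  have level: "(\<Sum>x | x \<in> U \<and> coef x \<delta> = r. real (chain_weight k x)) =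
      (\<Sum>x | x \<in> U \<and> coef x \<delta> = r. real (chain_weight k (x + \<delta>)))" for r
  proof -
    define V where "V = {x. x \<in> U \<and> coef x \<delta> = r}"
    have "(\<Sum>x\<in>V. chain_weight k x) = (\<Sum>x\<in>V. chain_weight k (x + \<delta>))"
    proof (rule toggle_symmetric)
      show "V \<subseteq> P" "(\<lambda>x. x + \<delta>) ` V \<subseteq> P" by (auto simp: V_def U_def)
      show "inj_on (\<lambda>x. x + \<delta>) V" by (auto intro: inj_onI)
    next
      fix z z' assume z: "z \<in> V" "z' \<in> V"
      show "le (z + \<delta>) (z' + \<delta>) \<longleftrightarrow> le z z'" by (simp add: root_le_def)
      show "le z (z' + \<delta>) \<longleftrightarrow> le z z'"
      proof
        assume "le z (z' + \<delta>)"
        then have "le (z + \<delta>) (z' + \<delta>)"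
          using z d' by (intro le_add_simple) (auto simp: V_def coef_simps)
        then show "le z z'" by (simp add: root_le_def)
      qed (use root_le_trans le_add[OF d] in blast)
      show "\<not> le (z + \<delta>) z'"
        using le_coef[of "z + \<delta>" z' \<delta>] z d' by (auto simp: V_def coef_simps)
    next
      fix z r' assume z: "z \<in> V" and r': "r' \<in> P - V - (\<lambda>x. x + \<delta>) ` V"
      have zP: "z \<in> P" "z + \<delta> \<in> P" "coef z \<delta> = r" using z by (auto simp: V_def U_def)
      have nV: "r' \<notin> V" "r' - \<delta> \<notin> V" using r' by (auto simp: image_iff)
      show "le r' z \<longleftrightarrow> le r' (z + \<delta>)"
      proof
        assume l: "le r' (z + \<delta>)"
        \<comment> \<open>With equal \<delta>-coefficients, \<open>down_closed\<close> would put
          \<open>r' - \<delta>\<close> into \<open>V\<close> and hence \<open>r'\<close> into the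
          upper layer, which was excluded.\<close>
        have ne: "coef r' \<delta> \<noteq> coef (z + \<delta>) \<delta>"
        proof
          assume eq: "coef r' \<delta> = coef (z + \<delta>) \<delta>"
          then have "r' - \<delta> \<in> P"
            using down_closed[OF d zP(2) _ _ l] zP r' by auto
          then show False using nV(2) eq r' zP d' by (auto simp: V_def U_def coef_simps)
        qed
        then have "le (r' + \<delta>) (z + \<delta>)" using le_add_simple[OF d' l] by simp
        then show "le r' z" by (simp add: root_le_def)
      qed (use root_le_trans le_add[OF d] in blast)
      show "le z r' \<longleftrightarrow> le (z + \<delta>) r'"
      proof
        assume l: "le z r'"
        have "coef z \<delta> \<noteq> coef r' \<delta>"
        proof
          assume eq: "coef z \<delta> = coef r' \<delta>"
          then have "r' + \<delta> \<in> P" using up_closed[OF d zP(1,2) _ l] r' by auto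
          then show False using nV(1) eq r' zP by (auto simp: V_def U_def)
        qed
        then show "le (z + \<delta>) r'" using le_add_simple[OF d' l] by simp
      qed (use root_le_trans le_add[OF d] in blast)
    qed
    then have "real (\<Sum>x\<in>V. chain_weight k x) = real (\<Sum>x\<in>V. chain_weight k (x + \<delta>))" by (rule arg_cong)
    then show ?thesis unfolding V_def of_nat_sum .
  qed
  have group: "(\<Sum>x\<in>U. h x * g (coef x \<delta>)) =
      (\<Sum>r\<in>(\<lambda>x. coef x \<delta>) ` U. (\<Sum>x | x \<in> U \<and> coef x \<delta> = r. h x) * g r)" for h
  proof -
    have "(\<Sum>x\<in>U. h x * g (coef x \<delta>)) =
        (\<Sum>r\<in>(\<lambda>x. coef x \<delta>) ` U. \<Sum>x | x \<in> U \<and> coef x \<delta> = r. h x * g (coef x \<delta>))"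
      by (rule sum.image_gen[OF fU])
    also have "\<dots> = (\<Sum>r\<in>(\<lambda>x. coef x \<delta>) ` U. \<Sum>x | x \<in> U \<and> coef x \<delta> = r. h x * g r)"
      by (intro sum.cong) auto
    finally show ?thesis by (simp add: sum_distrib_right)
  qed
  have "(\<Sum>x\<in>U. real (chain_weight k x) * g (coef x \<delta>)) =
      (\<Sum>x\<in>U. real (chain_weight k (x + \<delta>)) * g (coef x \<delta>))"
    unfolding group level ..
  then show "(\<Sum>x | x \<in> P \<and> x + \<delta> \<in> P. real (chain_weight k x) * g (coef x \<delta>)) =
      (\<Sum>x | x \<in> P \<and> x + \<delta> \<in> P. real (chain_weight k (x + \<delta>)) * g (coef x \<delta>))"
    by (simp add: U_def)
qed

lemma sum_toggle:
  fixes f h :: "'a \<Rightarrow> real"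
  assumes d: "\<delta> \<in> B"
  shows "(\<Sum>x\<in>P. f x * (h x * of_bool (x - \<delta> \<in> P))) = (\<Sum>x | x \<in> P \<and> x + \<delta> \<in> P. f (x + \<delta>) * h (x + \<delta>))"
    and "(\<Sum>x\<in>P. f x * (h x * of_bool (x + \<delta> \<in> P))) = (\<Sum>x | x \<in> P \<and> x + \<delta> \<in> P. f x * h x)"
proof -
  have "(\<Sum>x\<in>P. f x * (h x * of_bool (x - \<delta> \<in> P))) = (\<Sum>x | x \<in> P \<and> x - \<delta> \<in> P. f x * h x)"
    by (rule sum.mono_neutral_cong_right) (use fin in auto)
  also have "\<dots> = (\<Sum>x | x \<in> P \<and> x + \<delta> \<in> P. f (x + \<delta>) * h (x + \<delta>))"
    by (rule sum.reindex_bij_witness[of _ "\<lambda>x. x + \<delta>" "\<lambda>x. x - \<delta>"]) auto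
  finally show "(\<Sum>x\<in>P. f x * (h x * of_bool (x - \<delta> \<in> P))) =
    (\<Sum>x | x \<in> P \<and> x + \<delta> \<in> P. f (x + \<delta>) * h (x + \<delta>))" .
  show "(\<Sum>x\<in>P. f x * (h x * of_bool (x + \<delta> \<in> P))) = (\<Sum>x | x \<in> P \<and> x + \<delta> \<in> P. f x * h x)"
    by (rule sum.mono_neutral_cong_right) (use fin in auto)
qed

lemma sum_pairing_split:
  fixes f h :: "'a \<Rightarrow> real"
  assumes d: "\<delta> \<in> B"
  shows "(\<Sum>x\<in>P. f x * (h x * pairing \<delta> x)) =
    (\<Sum>x | x \<in> P \<and> x + \<delta> \<in> P. f (x + \<delta>) * h (x + \<delta>)) - (\<Sum>x | x \<in> P \<and> x + \<delta> \<in> P. f x * h x)"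
proof -
  have "(\<Sum>x\<in>P. f x * (h x * pairing \<delta> x)) =
      (\<Sum>x\<in>P. f x * (h x * of_bool (x - \<delta> \<in> P)) - f x * (h x * of_bool (x + \<delta> \<in> P)))"
    by (rule sum.cong) (simp_all add: pairing_toggle[OF d] algebra_simps)
  then show ?thesis by (simp add: sum_subtractf sum_toggle[OF d])
qed

lemma balanced_pairing:
  assumes "balanced f" "\<delta> \<in> B"
  shows "(\<Sum>x\<in>P. f x * pairing \<delta> x) = 0"
  using sum_pairing_split[OF assms(2), of f "\<lambda>_. 1"] assms(1)[unfolded balanced_def, rule_format, OF assms(2), of "\<lambda>_. 1"]
  by simp

text \<open>Passing from \<open>x\<close> to \<open>x + \<delta>\<close> raises the
  \<delta>-coefficient by 1. The common part cancels by balance, and the extra 1 counts the elements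
  from which \<delta> can be subtracted.\<close>

lemma balanced_coef_pairing:
  assumes "balanced f" "\<delta> \<in> B"
  shows "(\<Sum>x\<in>P. f x * (coef x \<delta> * pairing \<delta> x)) = (\<Sum>x\<in>P. f x * of_bool (x - \<delta> \<in> P))"
proof -
  have c: "coef (x + \<delta>) \<delta> = coef x \<delta> + 1" for x using B assms by (simp add: coef_simps)
  show ?thesis
    using sum_pairing_split[OF assms(2), of f "\<lambda>x. coef x \<delta>"] sum_toggle(1)[OF assms(2), of f "\<lambda>_. 1"]
      assms(1)[unfolded balanced_def, rule_format, OF assms(2), of "\<lambda>c. c"]
    by (simp add: c distrib_left sum.distrib)
qed

lemma pairing_expand: "x \<in> P \<Longrightarrow> 2 = pairing \<alpha> x + (\<Sum>\<delta>\<in>B. coef x \<delta> * pairing \<delta> x)"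
proof -
  assume x: "x \<in> P"
  have "2 = pairing x x" using pairing_self[OF P_root[OF x]] by simp
  also have "\<dots> = (\<Sum>\<delta>\<in>\<Delta>. coef x \<delta> * pairing \<delta> x)"
    unfolding pairing_def by (subst (1) expand_inner) (simp add: sum_distrib_left sum_divide_distrib mult_ac)
  also have "\<dots> = pairing \<alpha> x + (\<Sum>\<delta>\<in>B. coef x \<delta> * pairing \<delta> x)"
    using P_coef[OF x] by (simp add: sum.remove[OF finite_simple alpha] B_def)
  finally show ?thesis .
qed

section \<open>Weighted down-degrees and sums of coroots\<close>

definition alpha_sum :: "('a \<Rightarrow> real) \<Rightarrow> real" where
  "alpha_sum f = (\<Sum>x\<in>P. f x * pairing \<alpha> x)"

lemma balanced_down_degree:
  assumes "balanced f"
  shows "(\<Sum>x\<in>P. f x * real (down_degree P le x)) = 2 * (\<Sum>x\<in>P. f x) - alpha_sum f"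
proof -
  have "(\<Sum>x\<in>P. f x * real (down_degree P le x)) = (\<Sum>x\<in>P. \<Sum>\<delta>\<in>B. f x * of_bool (x - \<delta> \<in> P))"
  proof (rule sum.cong)
    fix x assume "x \<in> P"
    have "real (card {\<delta> \<in> B. x - \<delta> \<in> P}) = (\<Sum>\<delta>\<in>B. of_bool (x - \<delta> \<in> P))"
      using B(3) by (simp add: of_bool_def Int_def sum.If_cases)
    then show "f x * real (down_degree P le x) = (\<Sum>\<delta>\<in>B. f x * of_bool (x - \<delta> \<in> P))"
      using \<open>x \<in> P\<close> by (simp add: down_degree_eq sum_distrib_left)
  qed simp
  also have "\<dots> = (\<Sum>\<delta>\<in>B. \<Sum>x\<in>P. f x * (coef x \<delta> * pairing \<delta> x))"
    by (subst sum.swap) (simp add: balanced_coef_pairing[OF assms])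
  also have "\<dots> = (\<Sum>x\<in>P. f x * (2 - pairing \<alpha> x))"
    by (subst sum.swap) (rule sum.cong, simp_all add: pairing_expand flip: sum_distrib_left)
  also have "\<dots> = 2 * (\<Sum>x\<in>P. f x) - alpha_sum f"
    by (simp add: right_diff_distrib sum_subtractf alpha_sum_def sum_distrib_left mult.commute)
  finally show ?thesis .
qed

definition coroot_sum :: "('a \<Rightarrow> real) \<Rightarrow> 'a" where
  "coroot_sum f = (\<Sum>x\<in>P. (f x * (2 / (x \<bullet> x))) *\<^sub>R x)"

lemma inner_coroot_sum: "\<delta> \<bullet> coroot_sum f = (\<Sum>x\<in>P. f x * pairing \<delta> x)"
  by (simp add: coroot_sum_def inner_sum_right pairing_def mult_ac)

lemma coef_coroot_sum: "coef (coroot_sum f) \<alpha> = (\<Sum>x\<in>P. f x * (2 / (x \<bullet> x)))"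
  by (simp add: coroot_sum_def coef_sum coef_scale P_coef)

text \<open>The coroot sum of a balanced weight is orthogonal to \<open>B\<close>, so its inner
  product with another coroot sum involves only the coefficient of the latter at \<alpha>. The claim
  compares the two evaluations of one such product.\<close>

lemma balanced_proportional:
  assumes "balanced f" "balanced g"
  shows "(\<Sum>x\<in>P. f x * (2 / (x \<bullet> x))) * alpha_sum g = (\<Sum>x\<in>P. g x * (2 / (x \<bullet> x))) * alpha_sum f"
proof -
  have inner: "coroot_sum u \<bullet> coroot_sum v = coef (coroot_sum u) \<alpha> * alpha_sum v" if "balanced v" for u v
  proof -
    have "coroot_sum u \<bullet> coroot_sum v = (\<Sum>\<delta>\<in>\<Delta>. coef (coroot_sum u) \<delta> * (\<delta> \<bullet> coroot_sum v))"
      by (rule expand_inner)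
    also have "\<dots> = (\<Sum>\<delta>\<in>{\<alpha>}. coef (coroot_sum u) \<delta> * (\<delta> \<bullet> coroot_sum v))"
      by (rule sum.mono_neutral_right)
        (use finite_simple alpha balanced_pairing[OF that] in \<open>auto simp: B_def inner_coroot_sum\<close>)
    finally show ?thesis by (simp add: inner_coroot_sum alpha_sum_def)
  qed
  show ?thesis using inner[OF assms(1), of g] inner[OF assms(2), of f]
    by (simp add: coef_coroot_sum inner_commute)
qed

section \<open>Root lengths in a minuscule poset\<close>

definition neighbours :: "'a \<Rightarrow> 'a \<Rightarrow> bool" where
  "neighbours x y \<longleftrightarrow> x \<in> P \<and> y \<in> P \<and> (\<exists>\<delta>\<in>B. y = x + \<delta> \<or> x = y + \<delta>)"

lemma neighbours_P: "neighbours x y \<Longrightarrow> x \<in> P" "neighbours x y \<Longrightarrow> y \<in> P"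
  by (auto simp: neighbours_def)

lemma neighbours_sym: "neighbours x y \<Longrightarrow> neighbours y x"
  by (auto simp: neighbours_def)

lemma neighbours_inner:
  assumes "neighbours x y"
  shows "x \<noteq> y" "x \<bullet> y > 0"
proof -
  obtain \<delta> where d: "\<delta> \<in> B" "y = x + \<delta> \<or> x = y + \<delta>" using assms by (auto simp: neighbours_def)
  then show "x \<noteq> y" using root_nz[OF B_root[OF d(1)]] by auto
  note P = neighbours_P[OF assms]
  have "pairing y x > 0 \<or> pairing x y > 0"
    using d(2) pairing_BP[OF d(1) P(1)] pairing_BP[OF d(1) P(2)] pairing_self P_root P
    by (auto simp: pairing_add)
  then show "x \<bullet> y > 0" using pairing_sgn(1) P_root P by (auto simp: inner_commute)
qed

text \<open>Going down along covers leads from every element to \<alpha>, and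
  \<open>neighbours\<close> is symmetric, so \<open>Q\<close> holds everywhere or nowhere.\<close>

lemma P_connected:
  assumes "x0 \<in> P" "Q x0" "y \<in> P"
    and step: "\<And>x y. neighbours x y \<Longrightarrow> Q x \<Longrightarrow> Q y"
  shows "Q y"
proof -
  have "Q x \<longleftrightarrow> Q \<alpha>" if "x \<in> P" for x
    using that
  proof (induction "height x" arbitrary: x rule: less_induct)
    case less
    show ?case
    proof (cases "x = \<alpha>")
      case False
      obtain \<delta> where d: "\<delta> \<in> B" "x - \<delta> \<in> P"
        using step_down[OF alpha_P less.prems alpha_le[OF less.prems]] False by auto
      have "height (x - \<delta>) < height x" using height_add[OF d(2,1)] less.prems by simp
      moreover have "neighbours x (x - \<delta>)" using d less.prems by (auto simp: neighbours_def)
      ultimately show ?thesis using less.hyps d step neighbours_sym by blast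
    qed simp
  qed
  then show ?thesis using assms by blast
qed

lemma inner_cases:
  assumes "x \<in> P" "y \<in> P"
  shows "x \<bullet> y = 0 \<or> x \<bullet> y = y \<bullet> y / 2 \<or> x \<bullet> y = y \<bullet> y"
  using pairing_PP[OF assms] inner_pairing[OF P_root[OF assms(2)], of x] by auto

lemma inner_eq_imp:
  assumes "x \<bullet> y = x \<bullet> x" "x \<bullet> x = y \<bullet> y"
  shows "x = y"
proof -
  have "(x - y) \<bullet> (x - y) = 0" using assms by (simp add: inner_simps inner_commute)
  then show ?thesis by simp
qed

lemma ratio_cases:
  assumes "x \<in> P" "y \<in> P" "x \<noteq> y" "x \<bullet> y > 0"
  shows "(y \<bullet> y = x \<bullet> x \<and> x \<bullet> y = x \<bullet> x / 2) \<or> (y \<bullet> y = 2 * (x \<bullet> x) \<and> x \<bullet> y = x \<bullet> x) \<or>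
    (x \<bullet> x = 2 * (y \<bullet> y) \<and> x \<bullet> y = y \<bullet> y)"
  using inner_cases[OF assms(1,2)] inner_cases[OF assms(2,1)] inner_eq_imp[of x y] assms(3,4)
  by (auto simp: inner_commute)

text \<open>Here \<open>pairing y x = 2\<close>, so the negative of the reflection of
  \<open>y\<close> in \<open>x\<close> is the mirror image of \<open>y\<close> through the point
  \<open>x\<close>; its coefficient at \<alpha> is again 1.\<close>

lemma complement:
  assumes "x \<in> P" "y \<in> P" "x \<bullet> y = x \<bullet> x"
  shows "2 *\<^sub>R x - y \<in> P"
proof -
  have "pairing y x = 2" using assms P_pos[OF assms(1)] by (simp add: pairing_def inner_commute)
  then have "2 *\<^sub>R x - y \<in> \<Phi>"
    using root_minus[OF reflection[OF P_root[OF assms(1)] P_root[OF assms(2)]]] by simp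
  then show ?thesis using assms by (simp add: P_iff coef_simps)
qed

text \<open>\<open>N\<close> is the squared short length. Each element also gets a partner of the
  other length at an angle of 45 degrees; with the partners, the property can be propagated along
  neighbours.\<close>

definition two_lengths :: "real \<Rightarrow> bool" where
  "two_lengths N \<longleftrightarrow> N > 0 \<and> (\<forall>x\<in>P. (x \<bullet> x = N \<and> (\<exists>g\<in>P. g \<bullet> g = 2 * N \<and> x \<bullet> g = N)) \<or>
     (x \<bullet> x = 2 * N \<and> (\<exists>s\<in>P. s \<bullet> s = N \<and> s \<bullet> x = N)))"

text \<open>If the length changes along a cover, the two squared lengths have ratio 2 and the pair
  starts the property \<open>Q\<close>, which spreads over the connected \<open>P\<close>. Otherwise
  all lengths agree.\<close>

lemma lengths: "(\<forall>x\<in>P. x \<bullet> x = \<alpha> \<bullet> \<alpha>) \<or> (\<exists>N. two_lengths N)"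
proof (rule disjCI)
  assume no: "\<not> (\<exists>N. two_lengths N)"
  have eq: "x \<bullet> x = y \<bullet> y" if nb: "neighbours x y" for x y
  proof (rule ccontr)
    assume ne: "x \<bullet> x \<noteq> y \<bullet> y"
    obtain s g where sg: "s \<in> P" "g \<in> P" "g \<bullet> g = 2 * (s \<bullet> s)" "s \<bullet> g = s \<bullet> s"
      using ratio_cases[OF neighbours_P[OF nb] neighbours_inner[OF nb]] ne neighbours_P[OF nb]
      by (metis inner_commute)
    define N where "N = s \<bullet> s"
    have N: "N > 0" using P_pos[OF sg(1)] by (simp add: N_def)
    define Q where "Q x \<longleftrightarrow> (x \<bullet> x = N \<and> (\<exists>g\<in>P. g \<bullet> g = 2 * N \<and> x \<bullet> g = N)) \<or>
       (x \<bullet> x = 2 * N \<and> (\<exists>s\<in>P. s \<bullet> s = N \<and> s \<bullet> x = N))" for x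
    have step: "Q y" if nb: "neighbours x y" and Qx: "Q x" for x y
    proof -
      have xP: "x \<in> P" and yP: "y \<in> P" using neighbours_P[OF nb] by auto
      note r = ratio_cases[OF xP yP neighbours_inner[OF nb]]
      from Qx consider (short) g where "x \<bullet> x = N" "g \<in> P" "g \<bullet> g = 2 * N" "x \<bullet> g = N"
        | (long) s where "x \<bullet> x = 2 * N" "s \<in> P" "s \<bullet> s = N" "s \<bullet> x = N"
        unfolding Q_def by blast
      then show "Q y"
      proof cases
        case short
        \<comment> \<open>The mirror image of the partner \<open>g\<close> through \<open>x\<close>
          is a second long partner. The inner products of \<open>y\<close> with both add up to
          \<open>2 * (x \<bullet> y)\<close>, which yields a partner for a short \<open>y\<close>
          and excludes a smaller third length.\<close>
        define g' where "g' = 2 *\<^sub>R x - g"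
        have g': "g' \<in> P" unfolding g'_def by (rule complement) (use short xP in auto)
        have n': "g' \<bullet> g' = 2 * N" using short by (simp add: g'_def inner_simps inner_commute)
        have s: "y \<bullet> g + y \<bullet> g' = 2 * (x \<bullet> y)" by (simp add: g'_def inner_simps inner_commute)
        have a: "y \<bullet> g \<in> {0, N, 2 * N}" "y \<bullet> g' \<in> {0, N, 2 * N}"
          using inner_cases[OF yP short(2)] inner_cases[OF yP g'] short n' by auto
        have b: "y \<bullet> g \<in> {0, y \<bullet> y / 2, y \<bullet> y}" "y \<bullet> g' \<in> {0, y \<bullet> y / 2, y \<bullet> y}"
          using inner_cases[OF short(2) yP] inner_cases[OF g' yP] by (auto simp: inner_commute)
        from r consider "y \<bullet> y = N" "x \<bullet> y = N / 2" | "y \<bullet> y = 2 * N" "x \<bullet> y = N"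
          | "N = 2 * (y \<bullet> y)" "x \<bullet> y = y \<bullet> y" using short by auto
        then show ?thesis
        proof cases
          case 1
          then have "y \<bullet> g = N \<or> y \<bullet> g' = N" using a b s N by auto
          then show ?thesis using 1 short g' n' by (auto simp: Q_def)
        next
          case 2
          then show ?thesis using short xP by (auto simp: Q_def)
        next
          case 3
          then show ?thesis using a b s N by auto
        qed
      next
        case long
        \<comment> \<open>The mirror image of \<open>x\<close> through \<open>s\<close> has
          nonnegative inner product with \<open>y\<close>, so \<open>s \<bullet> y\<close> is at
          least half of \<open>x \<bullet> y\<close>. This makes \<open>s\<close> a partner of a
          long \<open>y\<close> and excludes a larger third length.\<close>
        define x' where "x' = 2 *\<^sub>R s - x"
        have x': "x' \<in> P" unfolding x'_def by (rule complement) (use long xP in auto)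
        have s: "2 * (s \<bullet> y) - x \<bullet> y \<ge> 0"
          using inner_PP[OF x' yP] by (simp add: x'_def inner_simps)
        have a: "s \<bullet> y \<in> {0, N / 2, N}"
          using inner_cases[OF yP long(2)] long by (auto simp: inner_commute)
        have b: "s \<bullet> y \<in> {0, y \<bullet> y / 2, y \<bullet> y}" using inner_cases[OF long(2) yP] by auto
        from r consider "y \<bullet> y = 2 * N" "x \<bullet> y = N" | "y \<bullet> y = 4 * N" "x \<bullet> y = 2 * N"
          | "y \<bullet> y = N" "x \<bullet> y = N" using long by auto
        then show ?thesis
        proof cases
          case 1
          then have "s \<bullet> y = N" using a b s N by auto
          then show ?thesis using 1 long by (auto simp: Q_def)
        next
          case 2
          then show ?thesis using a b s N by auto
        next
          case 3
          then show ?thesis using long xP by (auto simp: Q_def inner_commute)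
        qed
      qed
    qed
    have "Q s" using sg by (auto simp: Q_def N_def)
    then have "\<forall>z\<in>P. Q z" using P_connected[of s Q] sg(1) step by blast
    then have "two_lengths N" unfolding two_lengths_def Q_def using N by blast
    then show False using no by blast
  qed
  show "\<forall>x\<in>P. x \<bullet> x = \<alpha> \<bullet> \<alpha>"
    using P_connected[OF alpha_P, of "\<lambda>x. x \<bullet> x = \<alpha> \<bullet> \<alpha>"] eq by metis
qed

end

section \<open>Two root lengths: types B and C\<close>

locale minuscule_two_lengths = minuscule +
  fixes N :: real
  assumes two: "two_lengths N"
begin

lemma N: "N > 0"
  using two by (simp add: two_lengths_def)

definition short :: "'a \<Rightarrow> bool" where
  "short x \<longleftrightarrow> x \<in> P \<and> x \<bullet> x = N"

definition long :: "'a \<Rightarrow> bool" where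
  "long x \<longleftrightarrow> x \<in> P \<and> x \<bullet> x = 2 * N"

lemma short_or_long: "x \<in> P \<Longrightarrow> short x \<or> long x"
  using two by (auto simp: two_lengths_def short_def long_def)

lemma short_partner: "short x \<Longrightarrow> \<exists>g. long g \<and> x \<bullet> g = N"
  and long_partner: "long x \<Longrightarrow> \<exists>s. short s \<and> s \<bullet> x = N"
  using two N unfolding two_lengths_def short_def long_def by (metis field_sum_of_halves less_irrefl mult_2 add_cancel_left_left)+

lemma not_short_long: "short x \<Longrightarrow> long x \<Longrightarrow> False"
  using N by (auto simp: short_def long_def)

lemma inner_short_short: "short x \<Longrightarrow> short y \<Longrightarrow> x \<noteq> y \<Longrightarrow> x \<bullet> y = 0 \<or> x \<bullet> y = N / 2"
  using inner_cases[of x y] inner_eq_imp[of x y] by (auto simp: short_def)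

lemma inner_short_long: "short x \<Longrightarrow> long y \<Longrightarrow> x \<bullet> y = 0 \<or> x \<bullet> y = N"
  using inner_cases[of x y] inner_cases[of y x] N by (auto simp: short_def long_def inner_commute)

lemma inner_long_long: "long x \<Longrightarrow> long y \<Longrightarrow> x \<noteq> y \<Longrightarrow> x \<bullet> y = 0 \<or> x \<bullet> y = N"
  using inner_cases[of x y] inner_eq_imp[of x y] by (auto simp: long_def)

lemma partner_complement:
  assumes "short x" "long g" "x \<bullet> g = N"
  shows "long (2 *\<^sub>R x - g)" "x \<bullet> (2 *\<^sub>R x - g) = N"
proof -
  have "2 *\<^sub>R x - g \<in> P" by (rule complement) (use assms in \<open>auto simp: short_def long_def\<close>)
  then show "long (2 *\<^sub>R x - g)" "x \<bullet> (2 *\<^sub>R x - g) = N"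
    using assms by (auto simp: short_def long_def inner_simps inner_commute)
qed

lemma inner_reflected_sum: "y \<bullet> g + y \<bullet> (2 *\<^sub>R x - g) = 2 * (x \<bullet> y)"
  by (simp add: inner_simps inner_commute)

text \<open>The mirror image of \<open>g\<close> through \<open>s\<close> has nonnegative inner
  product with \<open>h\<close>, so \<open>s \<bullet> h\<close> is at least \<open>N / 2\<close>;
  its possible values are 0 and \<open>N\<close>.\<close>

lemma long_adjacent:
  assumes "short s" "long g" "s \<bullet> g = N" "long h" "g \<bullet> h = N"
  shows "s \<bullet> h = N"
proof -
  have "2 *\<^sub>R s - g \<in> P" using partner_complement[OF assms(1-3)] by (simp add: long_def)
  then have "(2 *\<^sub>R s - g) \<bullet> h \<ge> 0" using inner_PP assms by (simp add: long_def)
  then show ?thesis using inner_short_long[OF assms(1,4)] assms(5) N by (auto simp: inner_simps)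
qed

text \<open>
  A short \<open>s\<close> with two long partners at an angle of 60 degrees only occurs in type B, where \<open>s\<close> is
  the only short element of \<open>P\<close>.
\<close>

lemma unique_short:
  assumes s: "short s" and g: "long g" "s \<bullet> g = N" and h: "long h" "s \<bullet> h = N" and gh: "g \<bullet> h = N"
    and s': "short s'" "s' \<bullet> s = N / 2"
  shows False
proof -
  have aux: False if g: "long g" "s \<bullet> g = N" and h: "long h" "s \<bullet> h = N" and gh: "g \<bullet> h = N"
    and s'gh: "s' \<bullet> g = N" "s' \<bullet> h = N" for g h
  proof -
    have "2 *\<^sub>R s - h \<in> P" "2 *\<^sub>R s' - g \<in> P"
      using partner_complement(1)[OF s h] partner_complement(1)[OF s'(1) g(1) s'gh(1)] by (auto simp: long_def)
    then have "(2 *\<^sub>R s' - g) \<bullet> (2 *\<^sub>R s - h) \<ge> 0" using inner_PP by blast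
    moreover have "(2 *\<^sub>R s' - g) \<bullet> (2 *\<^sub>R s - h) = - N"
      using s'(2) s'gh g h gh by (simp add: inner_simps inner_commute)
    ultimately show False using N by simp
  qed
  \<comment> \<open>Exchanging \<open>g\<close> or \<open>h\<close> for its mirror image through
    \<open>s\<close> reduces to the situation of \<open>aux\<close>: \<open>s'\<close> is a partner
    of one element of each pair, and all four combinations have inner product
    \<open>N\<close>.\<close>
  define g' h' where "g' = 2 *\<^sub>R s - g" and "h' = 2 *\<^sub>R s - h"
  have g': "long g'" "s \<bullet> g' = N" and h': "long h'" "s \<bullet> h' = N"
    using partner_complement[OF s g] partner_complement[OF s h] by (auto simp: g'_def h'_def)
  have ps: "s' \<bullet> g + s' \<bullet> g' = N" "s' \<bullet> h + s' \<bullet> h' = N"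
    using s'(2) by (auto simp: g'_def h'_def inner_simps)
  have "g' \<bullet> h = N" "g \<bullet> h' = N"
    using gh g h by (simp_all add: g'_def h'_def inner_simps inner_commute)
  moreover then have "g' \<bullet> h' = N"
    using g' by (simp add: h'_def inner_simps inner_commute)
  moreover have "s' \<bullet> g = N \<or> s' \<bullet> g' = N" "s' \<bullet> h = N \<or> s' \<bullet> h' = N"
    using ps N inner_short_long[OF s'(1)] g(1) g'(1) h(1) h'(1) by fastforce+
  ultimately show False using aux g h g' h' gh by blast
qed

text \<open>By connectedness every element is \<open>s\<close> or a long partner of
  \<open>s\<close>. A positive inner product gives comparability, and an orthogonal pair consists of
  mirror images through \<open>s\<close>, which are compared via \<open>s\<close>.\<close>

lemma total_order:
  assumes s: "short s" and g: "long g" "s \<bullet> g = N" and h: "long h" "s \<bullet> h = N" and gh: "g \<bullet> h = N"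
  shows "P \<in> chains"
proof -
  have sP: "s \<in> P" using s by (simp add: short_def)
  note no = unique_short[OF s g h gh]
  define Q where "Q y \<longleftrightarrow> y = s \<or> (long y \<and> s \<bullet> y = N)" for y
  have step: "Q y" if nb: "neighbours x y" and Qx: "Q x" for x y
  proof -
    note r = ratio_cases[OF neighbours_P[OF nb] neighbours_inner[OF nb]]
    have yP: "y \<in> P" using neighbours_P[OF nb] by simp
    from short_or_long[OF yP] show "Q y"
    proof
      assume y: "long y"
      show ?thesis
      proof (cases "x = s")
        case True
        then show ?thesis using r y s N by (auto simp: Q_def short_def long_def)
      next
        case False
        then have x: "long x" "s \<bullet> x = N" using Qx by (auto simp: Q_def)
        from x y have "x \<bullet> x = 2 * N" "y \<bullet> y = 2 * N" by (auto simp: long_def)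
        then have "x \<bullet> y = N" using r N by linarith
        then show ?thesis using long_adjacent[OF s x y] y by (simp add: Q_def)
      qed
    next
      assume y: "short y"
      show ?thesis
      proof (cases "x = s")
        case True
        then have "y \<bullet> s = N / 2" using r y s N by (auto simp: short_def inner_commute)
        then show ?thesis using no y by blast
      next
        case False
        then have x: "long x" "s \<bullet> x = N" using Qx by (auto simp: Q_def)
        from x y have "x \<bullet> x = 2 * N" "y \<bullet> y = N" by (auto simp: short_def long_def)
        then have "x \<bullet> y = N" using r N by linarith
        moreover have "(2 *\<^sub>R s - x) \<bullet> y \<ge> 0"
          using partner_complement(1)[OF s x] yP inner_PP by (simp add: long_def)
        ultimately have "y \<bullet> s \<noteq> 0" using N by (auto simp: inner_simps inner_commute)
        then show ?thesis using inner_short_short[OF y s] no[OF y] by (auto simp: Q_def)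
      qed
    qed
  qed
  have Q: "Q y" if "y \<in> P" for y
    using P_connected[OF sP, of Q y] that step by (auto simp: Q_def)
  have "le x y \<or> le y x" if xy: "x \<in> P" "y \<in> P" for x y
  proof (cases "x \<bullet> y > 0")
    case True
    then show ?thesis using comparable xy by blast
  next
    case False
    then have 0: "x \<bullet> y = 0" using inner_PP[OF xy] by simp
    then have x: "long x" "s \<bullet> x = N" and y: "long y" "s \<bullet> y = N"
      using Q[OF xy(1)] Q[OF xy(2)] N s by (auto simp: Q_def inner_commute short_def)
    have y': "y = 2 *\<^sub>R s - x"
    proof (rule inner_eq_imp)
      show "y \<bullet> (2 *\<^sub>R s - x) = y \<bullet> y" "y \<bullet> y = (2 *\<^sub>R s - x) \<bullet> (2 *\<^sub>R s - x)"
        using x y 0 partner_complement(1)[OF s x] by (auto simp: inner_simps inner_commute long_def)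
    qed
    have "y - s = s - x" by (simp add: y' scaleR_2)
    then have "le x s \<longleftrightarrow> le s y" "le s x \<longleftrightarrow> le y s"
      unfolding root_le_def by (metis minus_diff_eq)+
    moreover have "le x s \<or> le s x" using comparable[of x s] x N xy sP by (simp add: inner_commute)
    ultimately show ?thesis using root_le_trans by blast
  qed
  then show ?thesis by (auto simp: chains_def)
qed

definition mid :: "'a \<Rightarrow> 'a \<Rightarrow> 'a" where
  "mid g h = (1 / 2) *\<^sub>R (g + h)"

lemma mid_commute: "mid g h = mid h g"
  by (simp add: mid_def add.commute)

lemma mid_self: "mid g g = g"
  by (simp add: mid_def flip: scaleR_2)

lemma mid_complement: "mid g (2 *\<^sub>R x - g) = x"
  by (simp add: mid_def)

text \<open>If \<alpha> were short, the mirror image of a long partner \<open>g\<close> through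
  \<alpha> would lie in \<open>P\<close>, hence above \<alpha>. Then \<open>g\<close> would lie
  below the minimum \<alpha>.\<close>

lemma alpha_long: "long \<alpha>"
proof (rule ccontr)
  assume "\<not> long \<alpha>"
  then have a: "short \<alpha>" using short_or_long alpha_P by blast
  then obtain g where g: "long g" "\<alpha> \<bullet> g = N" using short_partner by blast
  have "le \<alpha> (2 *\<^sub>R \<alpha> - g)" using partner_complement(1)[OF a g] alpha_le by (simp add: long_def)
  then have "le g \<alpha>" by (simp add: root_le_def scaleR_2)
  then have "g = \<alpha>" using g alpha_le alpha_P antisym by (auto simp: long_def)
  then show False using a g not_short_long by blast
qed

text \<open>Type C: the long elements are pairwise orthogonal.\<close>

context
  assumes no_adjacent: "\<And>s g h. short s \<Longrightarrow> long g \<Longrightarrow> s \<bullet> g = N \<Longrightarrow> long h \<Longrightarrow> s \<bullet> h = N \<Longrightarrow> g \<bullet> h \<noteq> N"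
begin

lemma long_orthogonal:
  assumes "long g" "long h" "g \<noteq> h"
  shows "g \<bullet> h = 0"
proof (rule ccontr)
  assume "\<not> ?thesis"
  then have gh: "g \<bullet> h = N" using inner_long_long assms by blast
  obtain s where s: "short s" "s \<bullet> g = N" using long_partner assms(1) by blast
  show False using no_adjacent[OF s(1) assms(1) s(2) assms(2)] long_adjacent[OF s(1) assms(1) s(2) assms(2) gh] gh by blast
qed

text \<open>In the nontrivial case the two midpoints have positive inner product, so their
  difference, half of \<open>g - k\<close>, is a root; its reflection in \<open>k\<close> is half of
  \<open>g + k\<close>.\<close>

lemma mid_trans:
  assumes "long g" "long h" "long k" "mid g h \<in> P" "mid h k \<in> P"
  shows "mid g k \<in> P"
proof (cases "g = h \<or> h = k \<or> g = k")
  case True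
  then show ?thesis using assms by (auto simp: mid_self long_def)
next
  case False
  then have o: "g \<bullet> h = 0" "h \<bullet> k = 0" "g \<bullet> k = 0"
    using assms long_orthogonal by auto
  have hh: "h \<bullet> h = 2 * N" "k \<bullet> k = 2 * N" using assms by (auto simp: long_def)
  have "mid g h \<noteq> mid h k" using False by (auto simp: mid_def add.commute)
  moreover have "mid g h \<bullet> mid h k > 0"
    using o hh N by (simp add: mid_def inner_simps inner_commute)
  ultimately have "mid g h - mid h k \<in> \<Phi>" using root_diff[OF assms(4,5)] by blast
  moreover have "mid g h - mid h k = (1 / 2) *\<^sub>R (g - k)"
    by (simp add: mid_def algebra_simps)
  ultimately have d: "(1 / 2) *\<^sub>R (g - k) \<in> \<Phi>" by simp
  have "pairing ((1 / 2) *\<^sub>R (g - k)) k = -1"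
    using o hh N by (simp add: pairing_def inner_simps)
  then have "(1 / 2) *\<^sub>R (g - k) + k \<in> \<Phi>"
    using reflection[OF P_root d, of k] assms by (simp add: long_def)
  moreover have "(1 / 2) *\<^sub>R (g - k) + k = mid g k"
    by (simp add: mid_def algebra_simps flip: scaleR_add_left)
  ultimately show ?thesis
    using assms by (simp add: P_iff long_def mid_def coef_simps)
qed

text \<open>A third partner would be orthogonal to \<open>g\<close> and to its mirror image, and
  hence to their midpoint \<open>x\<close>.\<close>

lemma partner_unique:
  assumes "short x" "long g" "x \<bullet> g = N" "long y" "x \<bullet> y = N"
  shows "y = g \<or> y = 2 *\<^sub>R x - g"
proof (rule disjCI)
  assume ne: "y \<noteq> 2 *\<^sub>R x - g"
  show "y = g"
  proof (rule ccontr)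
    assume "y \<noteq> g"
    then have "y \<bullet> g = 0" using long_orthogonal assms by blast
    moreover have "y \<bullet> (2 *\<^sub>R x - g) = 0"
      using long_orthogonal[OF assms(4) partner_complement(1)[OF assms(1-3)] ne] .
    ultimately show False using assms N by (simp add: inner_simps inner_commute)
  qed
qed

lemma neighbour_cases:
  assumes "x \<in> P" "y \<in> P" "x \<noteq> y" "x \<bullet> y > 0"
  shows "long x \<and> short y \<and> x \<bullet> y = N \<or> short x \<and> long y \<and> x \<bullet> y = N \<or>
    short x \<and> short y \<and> x \<bullet> y = N / 2"
  using short_or_long[OF assms(1)] short_or_long[OF assms(2)] inner_short_short[of x y]
    inner_short_long[of x y] inner_short_long[of y x] long_orthogonal[of x y] assms(3,4)
  by (auto simp: inner_commute)

text \<open>\<open>Q\<close> spreads from \<alpha> along neighbours; for a short element it refers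
  to a long partner. By \<open>jump\<close> one partner can be exchanged for the other, since
  \<open>x\<close> is their midpoint.\<close>

lemma mid_alpha:
  assumes "long g"
  shows "mid \<alpha> g \<in> P"
proof -
  define Q where "Q x \<longleftrightarrow> long x \<and> mid \<alpha> x \<in> P \<or>
     short x \<and> (\<exists>g. long g \<and> x \<bullet> g = N \<and> mid \<alpha> g \<in> P)" for x
  have "Q g"
  proof (rule P_connected[OF alpha_P])
    show "Q \<alpha>" using alpha_long alpha_P by (simp add: Q_def mid_self)
    show "g \<in> P" using assms by (simp add: long_def)
  next
    fix x y assume nb: "neighbours x y" and Qx: "Q x"
    note P = neighbours_P[OF nb]
    have jump: "mid \<alpha> (2 *\<^sub>R x - g) \<in> P" if "short x" "long g" "x \<bullet> g = N" "mid \<alpha> g \<in> P" for x g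
      using mid_trans[OF alpha_long that(2) partner_complement(1)[OF that(1-3)] that(4)] that(1)
      by (simp add: mid_complement short_def)
    from neighbour_cases[OF P neighbours_inner[OF nb]] show "Q y"
    proof (elim disjE conjE)
      assume "long x" "short y" "x \<bullet> y = N"
      then show ?thesis using Qx not_short_long by (auto simp: Q_def inner_commute)
    next
      assume xy: "short x" "long y" "x \<bullet> y = N"
      then obtain g where g: "long g" "x \<bullet> g = N" "mid \<alpha> g \<in> P"
        using Qx not_short_long by (auto simp: Q_def)
      then have "mid \<alpha> y \<in> P" using partner_unique[OF xy(1) g(1,2) xy(2,3)] jump[OF xy(1) g] by auto
      then show ?thesis using xy by (simp add: Q_def)
    next
      assume xy: "short x" "short y" "x \<bullet> y = N / 2"
      then obtain g where g: "long g" "x \<bullet> g = N" "mid \<alpha> g \<in> P"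
        using Qx not_short_long by (auto simp: Q_def)
      note c = partner_complement[OF xy(1) g(1,2)]
      have "y \<bullet> g = N \<or> y \<bullet> (2 *\<^sub>R x - g) = N"
        using inner_reflected_sum[of y g x] xy N
          inner_short_long[OF xy(2) g(1)] inner_short_long[OF xy(2) c(1)] by auto
      then show ?thesis using g c jump[OF xy(1) g] xy(2) by (auto simp: Q_def)
    qed
  qed
  then show ?thesis using assms not_short_long by (auto simp: Q_def)
qed

lemma mid_P: "long g \<Longrightarrow> long h \<Longrightarrow> mid g h \<in> P"
  using mid_trans[OF _ alpha_long] mid_alpha mid_commute by metis

text \<open>The midpoint is comparable to \<open>g\<close>, and \<open>h\<close> is the mirror image
  of \<open>g\<close> through it.\<close>

lemma long_comparable:
  assumes "long g" "long h"
  shows "le g h \<or> le h g"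
proof -
  have "mid g h \<bullet> g > 0"
    using long_orthogonal[OF assms] assms N by (cases "g = h") (auto simp: mid_def inner_simps long_def inner_commute)
  then have "le (mid g h) g \<or> le g (mid g h)"
    using comparable mid_P assms by (simp add: long_def)
  moreover have eq: "g - mid g h = mid g h - h"
    by (simp add: mid_def algebra_simps flip: scaleR_add_left)
  then have "le (mid g h) g \<longleftrightarrow> le h (mid g h)" "le g (mid g h) \<longleftrightarrow> le (mid g h) h"
    unfolding root_le_def by (metis minus_diff_eq)+
  ultimately show ?thesis using root_le_trans by blast
qed

section \<open>Down-degrees in type C\<close>

definition long_steps :: "'a \<Rightarrow> 'a set" where
  "long_steps g = {\<delta> \<in> B. long (g - 2 *\<^sub>R \<delta>)}"

lemma B_nz: "\<delta> \<in> B \<Longrightarrow> \<delta> \<noteq> 0"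
  using root_nz B_root by blast

lemma diff_inner:
  assumes "x \<in> P" "\<delta> \<in> B" "x - \<delta> \<in> P"
  shows "x \<noteq> x - \<delta>" "x \<bullet> (x - \<delta>) > 0"
proof -
  have "neighbours x (x - \<delta>)" using assms by (auto simp: neighbours_def)
  from neighbours_inner[OF this] show "x \<noteq> x - \<delta>" "x \<bullet> (x - \<delta>) > 0" .
qed

lemma long_steps_iff:
  assumes "long g"
  shows "long_steps g = {\<delta> \<in> B. g - \<delta> \<in> P}"
proof (intro set_eqI iffI CollectI conjI)
  fix \<delta> assume d: "\<delta> \<in> long_steps g"
  then show "\<delta> \<in> B" by (simp add: long_steps_def)
  have "mid g (g - 2 *\<^sub>R \<delta>) \<in> P" using d assms mid_P by (simp add: long_steps_def)
  moreover have "mid g (g - 2 *\<^sub>R \<delta>) = g - \<delta>" by (simp add: mid_def algebra_simps flip: scaleR_add_left)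
  ultimately show "g - \<delta> \<in> P" by simp
next
  fix \<delta> assume "\<delta> \<in> {\<delta> \<in> B. g - \<delta> \<in> P}"
  then have d: "\<delta> \<in> B" "g - \<delta> \<in> P" by auto
  have gP: "g \<in> P" using assms by (simp add: long_def)
  have y: "short (g - \<delta>)" "(g - \<delta>) \<bullet> g = N"
    using neighbour_cases[OF gP d(2) diff_inner[OF gP d]] assms not_short_long by (auto simp: inner_commute)
  have "long (2 *\<^sub>R (g - \<delta>) - g)" by (rule partner_complement(1)[OF y(1) assms y(2)])
  moreover have "2 *\<^sub>R (g - \<delta>) - g = g - 2 *\<^sub>R \<delta>" by (simp add: algebra_simps scaleR_2)
  ultimately show "\<delta> \<in> long_steps g" using d by (simp add: long_steps_def)
qed

text \<open>Two different steps would lead to incomparable long elements, contrary to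
  \<open>long_comparable\<close>; from the minimum \<alpha> there is no step.\<close>

lemma card_long_steps:
  assumes "long g"
  shows "card (long_steps g) = of_bool (g \<noteq> \<alpha>)"
proof (cases "g = \<alpha>")
  case True
  have "\<delta> \<notin> long_steps g" for \<delta>
  proof
    assume d: "\<delta> \<in> long_steps g"
    then have "le \<alpha> (\<alpha> - 2 *\<^sub>R \<delta>)" "\<delta> \<in> B" using True alpha_le by (auto simp: long_steps_def long_def)
    then show False using le_coef[of \<alpha> "\<alpha> - 2 *\<^sub>R \<delta>" \<delta>] B(1)[of \<delta>] alpha by (simp add: coef_simps)
  qed
  then show ?thesis using True by (simp add: card_eq_0_iff) blast
next
  case False
  have gP: "g \<in> P" using assms by (simp add: long_def)
  obtain \<delta> where d: "\<delta> \<in> long_steps g"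
    using step_down[OF alpha_P gP alpha_le[OF gP]] False unfolding long_steps_iff[OF assms] by auto
  have no: "\<not> le (g - 2 *\<^sub>R \<delta>) (g - 2 *\<^sub>R \<delta>')" if "\<delta> \<in> B" "\<delta>' \<in> B" "\<delta> \<noteq> \<delta>'" for \<delta> \<delta>'
    using le_coef[of "g - 2 *\<^sub>R \<delta>" "g - 2 *\<^sub>R \<delta>'" \<delta>'] B that by (auto simp: coef_simps)
  have "\<delta>' = \<delta>" if "\<delta>' \<in> long_steps g" for \<delta>'
    using no[of \<delta> \<delta>'] no[of \<delta>' \<delta>] long_comparable that d by (auto simp: long_steps_def)
  then have "long_steps g = {\<delta>}" using d by blast
  then show ?thesis using False by simp
qed

text \<open>A short element is the midpoint of two long ones and inherits the steps down of both;
  each of them has one unless it is \<alpha>. Each endpoint equal to \<alpha> contributes 2 to the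
  pairing, since the other long elements are orthogonal to \<alpha>.\<close>

lemma down_degree_two_lengths:
  assumes x: "x \<in> P"
  shows "real (down_degree P le x) = 1 + of_bool (short x) - pairing \<alpha> x / 2"
proof -
  have ag: "\<alpha> \<bullet> g = 2 * N * of_bool (g = \<alpha>)" if "long g" for g
    using long_orthogonal[OF alpha_long that] alpha_long by (auto simp: long_def)
  from short_or_long[OF x] show ?thesis
  proof
    assume g: "long x"
    then have "pairing \<alpha> x = 2 * of_bool (x = \<alpha>)" using N ag[OF g] by (simp add: pairing_def long_def)
    moreover have "down_degree P le x = of_bool (x \<noteq> \<alpha>)"
      using down_degree_eq[OF x] card_long_steps[OF g] by (simp add: long_steps_iff[OF g])
    moreover have "\<not> short x" using g not_short_long by blast
    ultimately show ?thesis by simp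
  next
    assume s: "short x"
    then obtain g where g: "long g" "x \<bullet> g = N" using short_partner by blast
    define h where "h = 2 *\<^sub>R x - g"
    have h: "long h" "x \<bullet> h = N" using partner_complement[OF s g] by (auto simp: h_def)
    have xm: "x = mid g h" by (simp add: h_def mid_complement)
    have gh: "g \<noteq> h"
    proof
      assume "g = h"
      then have "x = g" by (simp add: xm mid_self)
      then show False using s g not_short_long by blast
    qed
    have steps: "{\<delta> \<in> B. x - \<delta> \<in> P} = long_steps g \<union> long_steps h"
    proof (intro set_eqI iffI)
      fix \<delta> assume "\<delta> \<in> long_steps g \<union> long_steps h"
      then have "\<delta> \<in> B" "mid (g - 2 *\<^sub>R \<delta>) h \<in> P \<or> mid g (h - 2 *\<^sub>R \<delta>) \<in> P"
        using mid_P g h by (auto simp: long_steps_def)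
      moreover have "mid (g - 2 *\<^sub>R \<delta>) h = x - \<delta>" "mid g (h - 2 *\<^sub>R \<delta>) = x - \<delta>"
        by (simp_all add: xm mid_def algebra_simps)
      ultimately show "\<delta> \<in> {\<delta> \<in> B. x - \<delta> \<in> P}" by auto
    next
      fix \<delta> assume "\<delta> \<in> {\<delta> \<in> B. x - \<delta> \<in> P}"
      then have d: "\<delta> \<in> B" "x - \<delta> \<in> P" by auto
      have e: "2 *\<^sub>R (x - \<delta>) - g = h - 2 *\<^sub>R \<delta>" "2 *\<^sub>R (x - \<delta>) - h = g - 2 *\<^sub>R \<delta>"
        by (simp_all add: h_def algebra_simps)
      from neighbour_cases[OF x d(2) diff_inner[OF x d]] s
      consider (l) "long (x - \<delta>)" "x \<bullet> (x - \<delta>) = N" | (s) "short (x - \<delta>)" "x \<bullet> (x - \<delta>) = N / 2"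
        using not_short_long by blast
      then show "\<delta> \<in> long_steps g \<union> long_steps h"
      proof cases
        case l
        have "x - \<delta> = g \<or> x - \<delta> = h"
          using partner_unique[OF s g l] by (simp add: h_def)
        then have "2 *\<^sub>R (x - \<delta>) - g = g \<or> 2 *\<^sub>R (x - \<delta>) - h = h" by (auto simp: scaleR_2)
        then show ?thesis using e d g h by (auto simp: long_steps_def)
      next
        case s': s
        have "(x - \<delta>) \<bullet> g = N \<or> (x - \<delta>) \<bullet> h = N"
          using inner_reflected_sum[of "x - \<delta>" g x] s'(2) N inner_short_long[OF s'(1) g(1)] inner_short_long[OF s'(1) h(1)]
          by (auto simp: h_def)
        then show ?thesis
          using partner_complement(1)[OF s'(1) g(1)] partner_complement(1)[OF s'(1) h(1)] e d
          by (auto simp: long_steps_def)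
      qed
    qed
    have inner: "g \<bullet> \<delta> = N" if "long g" "\<delta> \<in> long_steps g" for g \<delta>
    proof -
      have l: "long (g - 2 *\<^sub>R \<delta>)" "g \<noteq> g - 2 *\<^sub>R \<delta>" using that B_nz by (auto simp: long_steps_def)
      then have "g \<bullet> (g - 2 *\<^sub>R \<delta>) = 0" using long_orthogonal that by blast
      then show ?thesis using that by (simp add: inner_simps long_def)
    qed
    \<comment> \<open>For a common step \<delta>, the inner product of \<open>h\<close> with the
      element \<open>g - 2 *\<^sub>R \<delta>\<close> of \<open>P\<close> would be
      \<open>- 2 * N\<close>.\<close>
    have disj: "long_steps g \<inter> long_steps h = {}"
    proof (rule ccontr)
      assume "long_steps g \<inter> long_steps h \<noteq> {}"
      then obtain \<delta> where d: "\<delta> \<in> long_steps g" "\<delta> \<in> long_steps h" by blast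
      have "(g - 2 *\<^sub>R \<delta>) \<bullet> h \<ge> 0" using d h inner_PP by (auto simp: long_steps_def long_def)
      then show False
        using inner[OF h(1) d(2)] long_orthogonal[OF g(1) h(1) gh] N by (simp add: inner_simps inner_commute)
    qed
    have "card {\<delta> \<in> B. x - \<delta> \<in> P} = card (long_steps g) + card (long_steps h)"
      unfolding steps by (rule card_Un_disjoint) (use disj B(3) in \<open>auto simp: long_steps_def\<close>)
    then have dd: "down_degree P le x = of_bool (g \<noteq> \<alpha>) + of_bool (h \<noteq> \<alpha>)"
      using down_degree_eq[OF x] card_long_steps g h by simp
    have "2 * (\<alpha> \<bullet> x) = \<alpha> \<bullet> g + \<alpha> \<bullet> h" by (simp add: h_def inner_simps)
    then have "pairing \<alpha> x = (2 * N * of_bool (g = \<alpha>) + 2 * N * of_bool (h = \<alpha>)) / N"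
      using s by (simp add: pairing_def ag g h short_def)
    then have "pairing \<alpha> x = 2 * of_bool (g = \<alpha>) + 2 * of_bool (h = \<alpha>)"
      using N by (simp add: add_divide_distrib)
    then show ?thesis using s by (simp add: dd)
  qed
qed

text \<open>Equating the two down-degree formulas gives the total weight \<open>S\<close> of the
  short elements. As \<open>2 * N / (x \<bullet> x)\<close> is 2 for short and 1 for long
  \<open>x\<close>, \<open>S\<close> determines the left-hand side.\<close>

lemma alpha_sum_two_lengths:
  assumes "balanced f"
  shows "N * (\<Sum>x\<in>P. f x * (2 / (x \<bullet> x))) = 2 * (\<Sum>x\<in>P. f x) - alpha_sum f / 2"
proof -
  define S where "S = (\<Sum>x\<in>P. f x * of_bool (short x))"
  have "(\<Sum>x\<in>P. f x * real (down_degree P le x)) = (\<Sum>x\<in>P. f x + f x * of_bool (short x) - f x * pairing \<alpha> x / 2)"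
    by (rule sum.cong) (simp_all add: down_degree_two_lengths algebra_simps)
  also have "\<dots> = (\<Sum>x\<in>P. f x) + S - alpha_sum f / 2"
    by (simp add: sum.distrib sum_subtractf S_def alpha_sum_def sum_divide_distrib)
  finally have S: "S = (\<Sum>x\<in>P. f x) - alpha_sum f / 2"
    using balanced_down_degree[OF assms] by simp
  have "N * (f x * (2 / (x \<bullet> x))) = f x + f x * of_bool (short x)" if "x \<in> P" for x
    using short_or_long[OF that] not_short_long[of x] N by (auto simp: short_def long_def)
  then have "N * (\<Sum>x\<in>P. f x * (2 / (x \<bullet> x))) = (\<Sum>x\<in>P. f x) + S"
    by (simp add: sum_distrib_left sum.distrib S_def)
  then show ?thesis using S by simp
qed

end

end

section \<open>The expectation identity and its conclusion\<close>

context minuscule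
begin

text \<open>The factor is the average down-degree under the uniform distribution, the same for all
  \<open>f\<close>. Unless \<open>P\<close> is a chain, the claim reduces to
  \<open>alpha_sum f\<close> being proportional to the total weight of \<open>f\<close>.\<close>

lemma balanced_expectation:
  assumes bal: "balanced f" and const: "P \<in> chains \<Longrightarrow> (\<And>x. x \<in> P \<Longrightarrow> f x = f \<alpha>)"
  shows "(\<Sum>x\<in>P. f x * real (down_degree P le x)) =
    (\<Sum>x\<in>P. real (down_degree P le x)) / real (card P) * (\<Sum>x\<in>P. f x)"
proof -
  define F where "F = (\<Sum>x\<in>P. f x)"
  define t where "t = alpha_sum (\<lambda>_. 1)"
  have card: "real (card P) > 0" using fin alpha_P by (auto simp: card_gt_0_iff)
  show ?thesis
  proof (cases "P \<in> chains")
    case True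
    have c: "f x = f \<alpha>" if "x \<in> P" for x using const[OF True that] .
    have "(\<Sum>x\<in>P. f x * real (down_degree P le x)) = f \<alpha> * (\<Sum>x\<in>P. real (down_degree P le x))"
      unfolding sum_distrib_left by (rule sum.cong) (use c in auto)
    moreover have "(\<Sum>x\<in>P. f x) = real (card P) * f \<alpha>" using c by simp
    ultimately show ?thesis using card by simp
  next
    case False
    have proportional: "F * t = real (card P) * alpha_sum f"
    proof -
      note p = balanced_proportional[OF bal balanced_one]
      from lengths show ?thesis
      proof
        assume l: "\<forall>x\<in>P. x \<bullet> x = \<alpha> \<bullet> \<alpha>"
        have s: "(\<Sum>x\<in>P. g x * (2 / (x \<bullet> x))) = 2 / (\<alpha> \<bullet> \<alpha>) * (\<Sum>x\<in>P. g x)" for g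
          unfolding sum_distrib_left by (rule sum.cong) (use l in auto)
        show ?thesis using p P_pos[OF alpha_P] unfolding s by (simp add: F_def t_def)
      next
        assume "\<exists>N. two_lengths N"
        then obtain N where "two_lengths N" by blast
        then interpret minuscule_two_lengths \<Phi> \<Delta> \<alpha> N by unfold_locales
        define a where "a g = (\<Sum>x\<in>P. g x * (2 / (x \<bullet> x)))" for g
        \<comment> \<open>Since \<open>P\<close> is not a chain, \<open>total_order\<close> rules
          out a short element with two long partners of inner product \<open>N\<close>; this is the
          assumption of the type C results.\<close>
        have s: "N * a g = 2 * (\<Sum>x\<in>P. g x) - alpha_sum g / 2" if "balanced g" for g
          unfolding a_def by (rule alpha_sum_two_lengths[OF _ that]) (use total_order False in blast)
        \<comment> \<open>The sum \<open>a f\<close> is eliminated by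
          \<open>balanced_proportional\<close>. The products of \<open>alpha_sum f\<close> and
          \<open>t\<close> on the two sides then cancel.\<close>
        have "(2 * F - alpha_sum f / 2) * t = N * (a f * t)"
          using s[OF bal] by (simp add: F_def)
        also have "\<dots> = N * (a (\<lambda>_. 1) * alpha_sum f)" using p by (simp only: a_def t_def)
        also have "\<dots> = (2 * real (card P) - t / 2) * alpha_sum f"
          using s[OF balanced_one] by (simp add: t_def)
        finally show ?thesis by (simp add: algebra_simps)
      qed
    qed
    have "(\<Sum>x\<in>P. real (down_degree P le x)) = 2 * real (card P) - t"
      using balanced_down_degree[OF balanced_one] by (simp add: t_def)
    moreover have "(2 * real (card P) - t) / real (card P) * F = 2 * F - alpha_sum f"
      using proportional card by (simp add: field_simps)
    ultimately show ?thesis using balanced_down_degree[OF bal] by (simp add: F_def)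
  qed
qed

lemma chain_weight_expectation:
  "(\<Sum>x\<in>P. real (chain_weight k x) * real (down_degree P le x)) =
    (\<Sum>x\<in>P. real (down_degree P le x)) / real (card P) * (\<Sum>x\<in>P. real (chain_weight k x))"
  by (rule balanced_expectation[OF balanced_chain_weight]) (simp add: chain_weight_total alpha_P)

text \<open>The minimum is \<alpha>, the maximum is the highest root, and \<open>height\<close> is
  the rank function.\<close>

lemma maxchain_iff:
  obtains n where "\<And>C. pred_on.maxchain P le C \<longleftrightarrow> C \<in> k_chains n"
proof -
  obtain \<theta> where \<theta>: "highest_root \<Phi> \<Delta> \<theta>" "coef \<theta> \<alpha> = 1"
    using minuscule by (auto simp: minuscule_root_def)
  have "\<theta> \<in> P" using \<theta> by (auto simp: P_iff highest_root_def positive_roots_def)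
  moreover have "le x \<theta>" if "x \<in> P" for x
    using \<theta> that by (auto simp: highest_root_def minuscule_poset_def)
  moreover have "\<exists>z\<in>P. le x z \<and> le z y \<and> height z = Suc (height x)"
    if "x \<in> P" "y \<in> P" "le x y" "x \<noteq> y" for x y
    using step_up[OF that] le_add height_add that by blast
  ultimately show thesis
    using that maxchain_iff_card[OF alpha_P alpha_le, of \<theta> height] height_strict by blast
qed

end

theorem theorem2p10:
  fixes \<Phi> \<Delta> :: "'a::euclidean_space set" and \<alpha> :: 'a
  assumes "irreducible_root_system \<Phi>"
    and "simple_roots \<Phi> \<Delta>"
    and "minuscule_root \<Phi> \<Delta> \<alpha>"
  shows "mCDE (minuscule_poset \<Phi> \<Delta> \<alpha>) (root_le \<Delta>) \<and>
         CDE (minuscule_poset \<Phi> \<Delta> \<alpha>) (root_le \<Delta>)"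
proof -
  interpret minuscule \<Phi> \<Delta> \<alpha>
    using assms by unfold_locales (auto simp: irreducible_root_system_def)
  have ne: "P \<noteq> {}" using alpha_P by blast
  obtain n where "\<And>C. pred_on.maxchain P le C \<longleftrightarrow> C \<in> k_chains n"
    using maxchain_iff by blast
  then show ?thesis
    using mCDE_if_chains_balanced(1)[OF ne chain_weight_expectation]
      CDE_if_chains_balanced[OF ne chain_weight_expectation] by blast
qed

end
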